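(* Let $\alpha,a,b,c,\beta,\gamma,u,v$ be complex parameters. Then \begin{align*} &\sum_{n=0}^\infty \frac{\bigl(1-\alpha q^{2n}\bigr)(\alpha, q/a, q/b, q/c; q)_n}{(1-\alpha)(q, \alpha a, \alpha b, \alpha c; q)_n}\biggl(\frac{\alpha abc}{q^2}\biggr)^n \sum_{k=0}^{n} \frac{(q^{-n}, \alpha q^n, \beta, \gamma; q)_k\, q^k}{(q, q/a, q/b, \beta \gamma uv; q)_k}\, {}_3\phi_2 \biggl({{q^{-k}, 1/u, 1/v}\atop{\beta, \gamma}}; q, \beta \gamma uv q^k\biggr)\\ &\qquad=\frac{(q\alpha, \alpha ac/q, \alpha bc/q, \alpha \beta ab/q, \alpha \gamma ab/q, \beta \gamma cuv/q; q )_\infty}{\bigl(\alpha a, \alpha b, \alpha c, \alpha \beta abc/q^2, \alpha \gamma abc/q^2, \beta \gamma uv; q \bigr)_\infty}\, {}_3\phi_2 \biggl({{q/c, \alpha ab/(qu), \alpha ab/(qv)}\atop{\alpha \beta ab/q, \alpha \gamma ab/q}}; q, \beta \gamma cuv/q \biggr), \end{align*} provided the series on both sides converge absolutely.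
   Context: Throughout, $q$ is a complex number with $0<|q|<1$. For $x\in\mathbb{C}$, $(x;q)_\infty=\prod_{k=0}^\infty(1-xq^k)$ and, for an integer $n\ge 0$, $(x;q)_n=(x;q)_\infty/(xq^n;q)_\infty=\prod_{k=0}^{n-1}(1-xq^k)$; also $(x_1,\dots,x_m;q)_n=(x_1;q)_n\cdots(x_m;q)_n$ for $n$ an integer or $\infty$. The basic hypergeometric series is ${}_r\phi_s\Bigl({{a_1,\dots,a_r}\atop{b_1,\dots,b_s}};q,z\Bigr)=\sum_{n=0}^\infty \frac{(a_1,\dots,a_r;q)_n}{(q,b_1,\dots,b_s;q)_n}\bigl((-1)^nq^{n(n-1)/2}\bigr)^{1+s-r}z^n$. *)

theory Defs
  imports "HOL-Analysis.Analysis"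
begin

definition qpoch :: "complex \<Rightarrow> complex \<Rightarrow> nat \<Rightarrow> complex" where
  "qpoch x q n = (\<Prod>k<n. 1 - x * q ^ k)"

definition qpoch_inf :: "complex \<Rightarrow> complex \<Rightarrow> complex" where
  "qpoch_inf x q = (\<Prod>k. 1 - x * q ^ k)"

definition qpochs :: "complex list \<Rightarrow> complex \<Rightarrow> nat \<Rightarrow> complex" where
  "qpochs xs q n = prod_list (map (\<lambda>x. qpoch x q n) xs)"

definition qpochs_inf :: "complex list \<Rightarrow> complex \<Rightarrow> complex" where
  "qpochs_inf xs q = prod_list (map (\<lambda>x. qpoch_inf x q) xs)"

definition qphi_term :: "complex list \<Rightarrow> complex list \<Rightarrow> complex \<Rightarrow> complex \<Rightarrow> nat \<Rightarrow> complex" where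
  "qphi_term as bs q z n =
     qpochs as q n / qpochs (q # bs) q n
     * ((-1) ^ n * q ^ (n * (n - 1) div 2)) powi (1 + int (length bs) - int (length as))
     * z ^ n"

definition qphi :: "complex list \<Rightarrow> complex list \<Rightarrow> complex \<Rightarrow> complex \<Rightarrow> complex" where
  "qphi as bs q z = (\<Sum>n. qphi_term as bs q z n)"

definition lhs_term ::
  "complex \<Rightarrow> complex \<Rightarrow> complex \<Rightarrow> complex \<Rightarrow> complex \<Rightarrow> complex \<Rightarrow> complex \<Rightarrow> complex \<Rightarrow> complex \<Rightarrow> nat \<Rightarrow> complex" where
  "lhs_term q \<alpha> a b c \<beta> \<gamma> u v n =
     (1 - \<alpha> * q ^ (2 * n)) * qpochs [\<alpha>, q / a, q / b, q / c] q n
       / ((1 - \<alpha>) * qpochs [q, \<alpha> * a, \<alpha> * b, \<alpha> * c] q n)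
     * (\<alpha> * a * b * c / q ^ 2) ^ n
     * (\<Sum>k\<le>n. qpochs [1 / q ^ n, \<alpha> * q ^ n, \<beta>, \<gamma>] q k * q ^ k
                  / qpochs [q, q / a, q / b, \<beta> * \<gamma> * u * v] q k
                  * qphi [1 / q ^ k, 1 / u, 1 / v] [\<beta>, \<gamma>] q (\<beta> * \<gamma> * u * v * q ^ k))"

end

theory Submission
  imports Defs "HOL-Computational_Algebra.Polynomial" "HOL-Complex_Analysis.Complex_Analysis"
begin

text \<open>Interchanging the two sums on the left is not legitimate for general \<open>c\<close>: for large \<open>k\<close> the resulting
  inner \<open>6\<phi>5\<close> has argument \<open>\<alpha> a b c q^(-k-2)\<close> and diverges. It is legitimate for \<open>c = q^(N+1)\<close>, where everything
  is finite. There the inner sum is a terminating \<open>6\<phi>5\<close>, and the claim reduces to a connection formula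
  expressing a terminating \<open>3\<phi>2\<close> with parameters \<open>(x/u, x/v; x \<beta>, x \<gamma>)\<close>, \<open>x = \<alpha> a b / q\<close>, through those with
  parameters \<open>(1/u, 1/v; \<beta>, \<gamma>)\<close>.

  For the given \<open>c\<close> not of this form, absolute convergence there forces uniform convergence on the disc of radius \<open>|c|\<close>,
  because the \<open>n\<close>-th terms depend on \<open>c\<close> essentially through \<open>c^n (q/c; q)_n\<close>, which is bounded by a constant times
  \<open>|c|^n\<close> there and is comparable to \<open>|c|^n\<close> at \<open>c\<close> itself. After clearing denominators both sides are
  holomorphic in the open disc, continuous on the closed one, and agree at the points \<open>q^(N+1)\<close>, which accumulate at
  \<open>0\<close>; so they agree at \<open>c\<close>.\<close>

section \<open>Finite q-shifted factorials\<close>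

lemma qpoch_0 [simp]: "qpoch x q 0 = 1"
  by (simp add: qpoch_def)

lemma qpoch_Suc: "qpoch x q (Suc n) = qpoch x q n * (1 - x * q ^ n)"
  by (simp add: qpoch_def)

lemma qpoch_add: "qpoch x q (m + n) = qpoch x q m * qpoch (x * q ^ m) q n"
  by (induction n) (simp_all add: qpoch_Suc power_add mult_ac)

lemma qpoch_Suc_front: "qpoch x q (Suc n) = (1 - x) * qpoch (x * q) q n"
  using qpoch_add[of x q 1 n] by (simp add: qpoch_Suc)

lemma qpoch_zero_left [simp]: "qpoch 0 q n = 1"
  by (simp add: qpoch_def)

lemma qpoch_1_left: "qpoch 1 q n = (if n = 0 then 1 else 0)"
  by (cases n) (simp_all add: qpoch_Suc_front)

text \<open>This is (-1)^n q^(n(n-1)/2), written as a product so that no halved exponent has to be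
  handled.\<close>

definition qsgn :: "complex \<Rightarrow> nat \<Rightarrow> complex" where
  "qsgn q n = (\<Prod>i<n. - (q ^ i))"

lemma qsgn_0 [simp]: "qsgn q 0 = 1"
  by (simp add: qsgn_def)

lemma qsgn_Suc: "qsgn q (Suc n) = - (q ^ n) * qsgn q n"
  by (simp add: qsgn_def)

lemma qsgn_add: "qsgn q (m + n) = qsgn q m * qsgn q n * q ^ (m * n)"
  by (induction n) (simp_all add: qsgn_Suc power_add mult_ac)

lemma qsgn_square: "qsgn q n * qsgn q n * q ^ n = q ^ (n * n)"
  by (induction n) (simp_all add: qsgn_Suc power_add mult_ac)

lemma qfact_nonzero:
  assumes "norm q < 1"
  shows "qpoch q q n \<noteq> 0"
proof -
  have "q * q ^ k \<noteq> 1" for k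
  proof
    assume "q * q ^ k = 1"
    hence "norm q ^ Suc k = 1"
      by (metis norm_one norm_power power_Suc)
    moreover have "norm q ^ Suc k < 1"
      using assms power_less_one_iff[of "norm q" "Suc k"] by simp
    ultimately show False by simp
  qed
  thus ?thesis by (simp add: qpoch_def)
qed

text \<open>The reversal formula for (q^-n; q)_j with n = j + r, free of subtraction and division.
  The induction keeps n fixed: removing the last factor lowers j and raises r, hence
  \<open>arbitrary: r\<close>.\<close>

lemma qpoch_neg_power:
  assumes "q \<noteq> 0"
  shows "qpoch (1 / q ^ (j + r)) q j * q ^ ((j + r) * j) * qpoch q q r = qsgn q j * qpoch q q (j + r)"
proof (induction j arbitrary: r)
  case 0
  thus ?case by simp
next
  case (Suc j)
  have *: "qpoch (1 / q ^ (j + Suc r)) q j * q ^ ((j + Suc r) * j) * qpoch q q (Suc r)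
      = qsgn q j * qpoch q q (j + Suc r)"
    by (rule Suc.IH)
  have 1: "(1 - 1 / q ^ (j + Suc r) * q ^ j) * q ^ (j + Suc r) = - (q ^ j) * (1 - q * q ^ r)"
    using assms by (simp add: field_simps power_add)
  have "qpoch (1 / q ^ (Suc j + r)) q (Suc j) * q ^ ((Suc j + r) * Suc j) * qpoch q q r
      = qpoch (1 / q ^ (j + Suc r)) q j * q ^ ((j + Suc r) * j) * qpoch q q r
        * ((1 - 1 / q ^ (j + Suc r) * q ^ j) * q ^ (j + Suc r))"
    by (simp add: qpoch_Suc power_add mult_ac)
  also have "\<dots> = - (q ^ j) * (qpoch (1 / q ^ (j + Suc r)) q j * q ^ ((j + Suc r) * j) * qpoch q q (Suc r))"
    unfolding 1 by (simp add: qpoch_Suc mult_ac)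
  also have "\<dots> = qsgn q (Suc j) * qpoch q q (Suc j + r)"
    unfolding * by (simp add: qsgn_Suc)
  finally show ?case .
qed

lemma qpoch_neg_power_eq_0:
  assumes "q \<noteq> 0" "n < j"
  shows "qpoch (1 / q ^ n) q j = 0"
  using assms by (auto simp: qpoch_def)

subsection \<open>The terminating very-well-poised 6-phi-5 sum\<close>

text \<open>The \<open>m\<close>-th term of the very-well-poised \<open>6\<phi>5(A; B, C, q^-M)\<close> at argument \<open>A q^(M+1) / (B C)\<close>,
  multiplied by \<open>(1 - A) (A q^(M+1), A q/B, A q/C; q)_M / (q; q)_M\<close> so that no factor depending on \<open>A\<close>
  remains in a denominator.\<close>

definition sixphi5_summand :: "complex \<Rightarrow> complex \<Rightarrow> complex \<Rightarrow> complex \<Rightarrow> nat \<Rightarrow> nat \<Rightarrow> complex" where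
  "sixphi5_summand q A B C M m =
     (1 - A * q ^ (2 * m)) * qpoch A q m * qpoch B q m * qpoch C q m * qsgn q m * (A * q / (B * C)) ^ m
     * qpoch (A * q ^ (M + 1 + m)) q (M - m)
     * qpoch (A * q / B * q ^ m) q (M - m) * qpoch (A * q / C * q ^ m) q (M - m)
     / (qpoch q q m * qpoch q q (M - m))"

text \<open>WZ certificate for the first-order recurrence of the sum in \<open>M\<close>.\<close>

definition sixphi5_cert :: "complex \<Rightarrow> complex \<Rightarrow> complex \<Rightarrow> complex \<Rightarrow> nat \<Rightarrow> nat \<Rightarrow> complex" where
  "sixphi5_cert q A B C M i =
     - (q ^ M / q ^ i) * qpoch A q (Suc i) * qpoch B q (Suc i) * qpoch C q (Suc i)
     * qsgn q (Suc i) * (A * q / (B * C)) ^ Suc i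
     * qpoch (A * q ^ (M + 2 + i)) q (M + 1 - i)
     * qpoch (A * q / B * q ^ i) q (M - i) * qpoch (A * q / C * q ^ i) q (M - i)
     / (qpoch q q i * qpoch q q (M - i))"

text \<open>This is what remains of the WZ equation at index m after division by the common factors,
  with Y = q^m and K = q^(M+1). It is a rational identity in independent variables, so clearing
  denominators leaves polynomial algebra.\<close>

lemma sixphi5_cert_identity:
  fixes q A B C K Y :: complex
  assumes "q \<noteq> 0" "B \<noteq> 0" "C \<noteq> 0" "Y \<noteq> 0" "K \<noteq> Y"
  shows "(1 - A * Y\<^sup>2) * ((1 - K) * (1 - A / B * K) * (1 - A / C * K) / (1 - K / Y)
            - (1 - A * K / (B * C)) * (1 - A * K * Y))
       = K / (q * Y) * (1 - A * Y) * (1 - B * Y) * (1 - C * Y) * (Y * (A * q / (B * C)))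
         + K / Y * (1 - Y) * (1 - A / B * Y) * (1 - A / C * Y) * (1 - A * K * Y) / (1 - K / Y)"
proof -
  have "1 - K / Y \<noteq> 0" using assms by (simp add: field_simps)
  moreover have "1 - K / Y = (Y - K) / Y" using assms by (simp add: field_simps)
  ultimately show ?thesis using assms
    apply (simp add: divide_simps)
    apply algebra
    done
qed

text \<open>The WZ equation at one index j. Writing M = j + r avoids natural subtraction and
  restricts it to j \<le> M, where the summands for both M and M + 1 are meaningful.\<close>

lemma sixphi5_step:
  fixes q A B C :: complex
  assumes q: "q \<noteq> 0" "norm q < 1" and BC: "B \<noteq> 0" "C \<noteq> 0"
  defines "D \<equiv> \<lambda>M m. (1 - q ^ Suc M) * sixphi5_summand q A B C (Suc M) m
      - (1 - A * q ^ (2 * M + 1)) * (1 - A * q ^ (2 * M + 2)) * (1 - A * q ^ Suc M / (B * C))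
        * sixphi5_summand q A B C M m"
  shows "D (j + r) j = sixphi5_cert q A B C (j + r) j
           - (if j = 0 then 0 else sixphi5_cert q A B C (j + r) (j - 1))"
proof -
  define Y K z where "Y = q ^ j" and "K = q ^ Suc (j + r)" and "z = A * q / (B * C)"
  \<comment> \<open>All four terms of the equation are rational functions of Y and K times the
    common factor X P E F / R.\<close>
  define P E F R X where "P = qpoch (A * q ^ (j + r + 2 + j)) q (Suc r)"
    and "E = qpoch (A * q / B * Y) q r" and "F = qpoch (A * q / C * Y) q r"
    and "R = qpoch q q j * qpoch q q r"
    and "X = qpoch A q j * qpoch B q j * qpoch C q j * qsgn q j * z ^ j"
  have Y: "Y \<noteq> 0" using q by (simp add: Y_def)
  have R: "R \<noteq> 0" using qfact_nonzero q by (simp add: R_def)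
  have KY: "K / Y = q * q ^ r" using q by (simp add: K_def Y_def power_add)
  have r: "1 - K / Y \<noteq> 0"
    using qfact_nonzero[OF q(2), of "Suc r"] unfolding qpoch_Suc KY by simp
  have pw: "q ^ (j + r) = K / q" "q ^ (2 * j) = Y\<^sup>2" "q ^ (j * 2) = Y\<^sup>2" "q ^ r = K / (q * Y)"
    using q by (simp_all add: K_def Y_def power_add power_mult[symmetric] mult.commute)
  have summand1: "sixphi5_summand q A B C (Suc (j + r)) j
      = (1 - A * Y\<^sup>2) * X * P * (E * (1 - A / B * K)) * (F * (1 - A / C * K)) / (R * (1 - K / Y))"
    using q Y
    by (simp add: sixphi5_summand_def P_def E_def F_def R_def X_def z_def[symmetric] pw Y_def[symmetric]
        Suc_diff_le qpoch_Suc mult_ac power_add add_ac)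
  \<comment> \<open>Adding one factor at the front of P gives r + 2 factors, the last two of which
    are precisely those in the coefficient of the recurrence.\<close>
  have "P * (1 - A * K * Y) = qpoch (A * q ^ (j + r + 1 + j)) q (Suc (Suc r))"
    unfolding qpoch_Suc_front[of _ _ "Suc r"] P_def by (simp add: K_def Y_def power_add mult_ac)
  also have "\<dots> = qpoch (A * q ^ (j + r + 1 + j)) q r * (1 - A * q ^ (2 * (j + r) + 1)) * (1 - A * q ^ (2 * (j + r) + 2))"
    by (simp add: qpoch_Suc power_add mult_ac mult_2 mult_2_right)
  finally have P: "qpoch (A * q ^ (j + r + 1 + j)) q r * (1 - A * q ^ (2 * (j + r) + 1)) * (1 - A * q ^ (2 * (j + r) + 2))
     = P * (1 - A * K * Y)" ..
  have "(1 - A * q ^ (2 * (j + r) + 1)) * (1 - A * q ^ (2 * (j + r) + 2)) * sixphi5_summand q A B C (j + r) j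
      = (1 - A * Y\<^sup>2) * X * (qpoch (A * q ^ (j + r + 1 + j)) q r * (1 - A * q ^ (2 * (j + r) + 1)) * (1 - A * q ^ (2 * (j + r) + 2))) * E * F / R"
    by (simp add: sixphi5_summand_def E_def F_def R_def X_def z_def[symmetric] pw Y_def[symmetric] mult_ac)
  hence summand2: "(1 - A * q ^ (2 * (j + r) + 1)) * (1 - A * q ^ (2 * (j + r) + 2)) * sixphi5_summand q A B C (j + r) j
      = (1 - A * Y\<^sup>2) * X * P * (1 - A * K * Y) * E * F / R"
    unfolding P by (simp add: mult_ac)
  have cert1: "sixphi5_cert q A B C (j + r) j
     = K / (q * Y) * (1 - A * Y) * (1 - B * Y) * (1 - C * Y) * (Y * z) * (X * P * E * F / R)"
    using q
    by (simp add: sixphi5_cert_def qpoch_Suc qsgn_Suc pw P_def E_def F_def R_def X_def z_def[symmetric]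
        Y_def[symmetric] mult_ac)
  \<comment> \<open>The factor 1 - Y vanishes at j = 0, so a single closed form covers the missing
    certificate at index -1 as well.\<close>
  have cert2: "(if j = 0 then 0 else sixphi5_cert q A B C (j + r) (j - 1))
     = - (K / Y * (1 - Y) * (1 - A / B * Y) * (1 - A / C * Y) * (1 - A * K * Y) / (1 - K / Y)) * (X * P * E * F / R)"
  proof (cases j)
    case 0
    thus ?thesis by (simp add: Y_def)
  next
    case (Suc i)
    have Yi: "q ^ i = Y / q" using q by (simp add: Y_def Suc)
    have "qpoch q q j = qpoch q q i * (1 - Y)" by (simp add: Suc Y_def qpoch_Suc)
    hence 1: "inverse (qpoch q q i) = (1 - Y) / qpoch q q j" and Yn: "1 - Y \<noteq> 0"
      using qfact_nonzero[OF q(2), of j] qfact_nonzero[OF q(2), of i] by (auto simp: field_simps)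
    have 2: "qpoch q q (Suc r) = qpoch q q r * (1 - K / Y)" by (simp add: qpoch_Suc KY)
    have 3: "qpoch (A * q / B * q ^ i) q (Suc r) = (1 - A / B * Y) * E"
      "qpoch (A * q / C * q ^ i) q (Suc r) = (1 - A / C * Y) * F"
      unfolding qpoch_Suc_front E_def F_def Yi using q by (simp_all add: mult_ac)
    have 4: "qpoch (A * q ^ (j + r + 2 + i)) q (Suc (Suc r)) = (1 - A * K * Y) * P"
      unfolding qpoch_Suc_front[of _ _ "Suc r"] P_def Suc by (simp add: K_def Y_def power_add mult_ac Suc)
    have 5: "q ^ (j + r) / q ^ i = K / Y" unfolding pw Yi using q by simp
    have 6: "j + r + 1 - i = Suc (Suc r)" "j + r - i = Suc r" using Suc by simp_all
    have "sixphi5_cert q A B C (j + r) i = - (K / Y) * X * ((1 - A * K * Y) * P)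
        * ((1 - A / B * Y) * E) * ((1 - A / C * Y) * F) * inverse (qpoch q q i) / (qpoch q q r * (1 - K / Y))"
      unfolding sixphi5_cert_def 5 6 2 3 4 X_def z_def[symmetric] Suc[symmetric] by (simp add: field_simps)
    thus ?thesis
      unfolding 1 R_def using Suc by (simp add: mult_ac)
  qed
  have "D (j + r) j = (1 - A * Y\<^sup>2) * ((1 - K) * (1 - A / B * K) * (1 - A / C * K) / (1 - K / Y)
            - (1 - A * K / (B * C)) * (1 - A * K * Y)) * (X * P * E * F / R)"
  proof -
    have "D (j + r) j = (1 - K) * sixphi5_summand q A B C (Suc (j + r)) j
      - (1 - A * K / (B * C)) * ((1 - A * q ^ (2 * (j + r) + 1)) * (1 - A * q ^ (2 * (j + r) + 2))
        * sixphi5_summand q A B C (j + r) j)"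
      unfolding D_def K_def by (simp add: mult_ac)
    moreover have "k * (t * X * P * (E * s) * (F * u) / (R * p)) - l * (t * X * P * y * E * F / R)
        = t * (k * s * u / p - l * y) * (X * P * E * F / R)" for k l p s t u y
      by (simp add: algebra_simps)
    ultimately show ?thesis
      unfolding summand1 summand2 by simp
  qed
  also have "\<dots> = (K / (q * Y) * (1 - A * Y) * (1 - B * Y) * (1 - C * Y) * (Y * z)
         + K / Y * (1 - Y) * (1 - A / B * Y) * (1 - A / C * Y) * (1 - A * K * Y) / (1 - K / Y)) * (X * P * E * F / R)"
    unfolding z_def by (subst sixphi5_cert_identity) (use q BC Y r in auto)
  finally show ?thesis
    unfolding cert1 cert2 by (simp only: distrib_right minus_mult_left[symmetric] diff_minus_eq_add)
qed

lemma sixphi5_partial: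
  assumes q: "q \<noteq> 0" "norm q < 1" and BC: "B \<noteq> 0" "C \<noteq> 0" and "i \<le> M"
  shows "(\<Sum>m\<le>i. (1 - q ^ Suc M) * sixphi5_summand q A B C (Suc M) m
      - (1 - A * q ^ (2 * M + 1)) * (1 - A * q ^ (2 * M + 2)) * (1 - A * q ^ Suc M / (B * C))
        * sixphi5_summand q A B C M m) = sixphi5_cert q A B C M i"
  using \<open>i \<le> M\<close>
proof (induction i)
  case 0
  show ?case using sixphi5_step[OF q BC, where j=0 and r=M] by simp
next
  case (Suc i)
  show ?case
    unfolding sum.atMost_Suc Suc.IH[OF Suc_leD[OF Suc.prems]]
    using sixphi5_step[OF q BC, where j="Suc i" and r="M - Suc i" and A=A] Suc.prems by simp
qed

text \<open>In the usual normalisation this is Rogers' evaluation (A q, A q/(B C); q)_M / (A q/B, A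
  q/C; q)_M. Telescoping the WZ equation gives a first-order recurrence in M, which the right side
  also satisfies.\<close>

theorem sixphi5_sum:
  assumes q: "q \<noteq> 0" "norm q < 1" and BC: "B \<noteq> 0" "C \<noteq> 0"
  shows "(\<Sum>m\<le>M. sixphi5_summand q A B C M m)
           = qpoch A q (2 * M + 1) * qpoch (A * q / (B * C)) q M / qpoch q q M"
proof (induction M)
  case 0
  show ?case by (simp add: sixphi5_summand_def qpoch_Suc)
next
  case (Suc M)
  let ?S = "\<lambda>M. \<Sum>m\<le>M. sixphi5_summand q A B C M m"
  let ?c = "(1 - A * q ^ (2 * M + 1)) * (1 - A * q ^ (2 * M + 2)) * (1 - A * q ^ Suc M / (B * C))"
  have nz: "qpoch q q M \<noteq> 0" "qpoch q q (Suc M) \<noteq> 0"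
    using qfact_nonzero q by auto
  hence nz': "1 - q ^ Suc M \<noteq> 0" by (simp add: qpoch_Suc)
  have cancel: "s - t = u \<Longrightarrow> s + - u = t" for s t u :: complex
    by auto
  \<comment> \<open>The telescoped range stops at M. The remaining term m = M + 1 occurs only in the
    longer sum and cancels the boundary value of the certificate.\<close>
  have last: "(1 - q ^ Suc M) * sixphi5_summand q A B C (Suc M) (Suc M) = - sixphi5_cert q A B C M M"
  proof -
    have 1: "qpoch (A * q ^ (M + 2 + M)) q (M + 1 - M) = 1 - A * q ^ (2 * Suc M)"
      by (simp add: qpoch_Suc mult_2 power_add)
    have 2: "qpoch q q (Suc M) = qpoch q q M * (1 - q ^ Suc M)"
      by (simp add: qpoch_Suc)
    have 3: "q ^ M / q ^ M = 1" using q by simp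
    show ?thesis
      using nz nz' unfolding sixphi5_summand_def sixphi5_cert_def 1 2 3 by (simp add: mult_ac)
  qed
  have "(1 - q ^ Suc M) * (\<Sum>m\<le>M. sixphi5_summand q A B C (Suc M) m) - ?c * ?S M = sixphi5_cert q A B C M M"
    unfolding sum_distrib_left sum_subtractf[symmetric] by (rule sixphi5_partial[OF q BC order_refl])
  hence "(1 - q ^ Suc M) * ?S (Suc M) = ?c * ?S M"
    unfolding sum.atMost_Suc distrib_left last by (rule cancel)
  also have "\<dots> = (1 - q ^ Suc M) * (qpoch A q (2 * Suc M + 1) * qpoch (A * q / (B * C)) q (Suc M) / qpoch q q (Suc M))"
    unfolding Suc.IH using nz nz' by (simp add: qpoch_Suc mult_ac)
  finally show ?case by (rule mult_left_cancel[OF nz', THEN iffD1])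
qed

subsection \<open>A scaling property of terminating 3-phi-2 series\<close>

text \<open>Up to the factor \<open>qpoch q q N / (qpoch B q N * qpoch C q N)\<close>, this is the terminating
  \<open>3\<phi>2(q^-N, U, V; B, C; q, w q^N)\<close>, written without denominators that can vanish.\<close>

definition tphi_summand :: "complex \<Rightarrow> complex \<Rightarrow> complex \<Rightarrow> complex \<Rightarrow> complex \<Rightarrow> complex \<Rightarrow> nat \<Rightarrow> nat \<Rightarrow> complex" where
  "tphi_summand q w U V B C N j =
     qsgn q j * w ^ j * qpoch U q j * qpoch V q j
     * qpoch (B * q ^ j) q (N - j) * qpoch (C * q ^ j) q (N - j) / (qpoch q q j * qpoch q q (N - j))"

definition tphi :: "complex \<Rightarrow> complex \<Rightarrow> complex \<Rightarrow> complex \<Rightarrow> complex \<Rightarrow> complex \<Rightarrow> nat \<Rightarrow> complex" where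
  "tphi q w U V B C N = (\<Sum>j\<le>N. tphi_summand q w U V B C N j)"

text \<open>Telescopes the contiguous relation between \<open>tphi\<close> at \<open>(U, V, B, C)\<close> and at \<open>(q U, q V, q B, q C)\<close>.\<close>

definition tphi_cert :: "complex \<Rightarrow> complex \<Rightarrow> complex \<Rightarrow> complex \<Rightarrow> complex \<Rightarrow> complex \<Rightarrow> nat \<Rightarrow> nat \<Rightarrow> complex" where
  "tphi_cert q w U V B C M i =
     q ^ Suc M * (U * V - 1 / q ^ Suc i) * qsgn q (Suc i) * w ^ Suc i * qpoch (q * U) q i * qpoch (q * V) q i
     * qpoch (B * q ^ Suc i) q (M - i) * qpoch (C * q ^ Suc i) q (M - i) / (qpoch q q i * qpoch q q (M - i))"

text \<open>The summand equation for j > 0 after removal of common factors, with y = q^j and K =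
  q^(M+1). The balance w U V = B C is what makes it telescope, and it survives scaling U, V, B, C by
  a common x.\<close>

lemma tphi_cert_identity:
  fixes q w U V B C K y :: complex
  assumes "q \<noteq> 0" "y \<noteq> 0" "K \<noteq> y" "w * U * V = B * C"
  shows "(1 - U * y) * (1 - V * y) * ((1 - B * K) * (1 - C * K) / (1 - K / y) - (1 - w * (K / q)))
           - K * (1 - U) * (1 - V) * (1 - B * y) * (1 - C * y) / (1 - K / y)
         = K * (U * V - 1 / (q * y)) * (- y * w) * ((1 - U * y) * (1 - V * y))
           - K * (U * V - 1 / y) * (1 - y) * (1 - B * y) * (1 - C * y) / (1 - K / y)"
proof -
  have "1 - K / y \<noteq> 0" using assms by (simp add: field_simps)
  moreover have "1 - K / y = (y - K) / y" using assms by (simp add: field_simps)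
  ultimately show ?thesis using assms
    apply (simp add: divide_simps)
    apply algebra
    done
qed

lemma tphi_step:
  fixes q w U V B C :: complex
  assumes q: "q \<noteq> 0" "norm q < 1" and w: "w * U * V = B * C"
  shows "tphi_summand q w (q * U) (q * V) (q * B) (q * C) (Suc (j + r)) j
      - (1 - w * q ^ (j + r)) * tphi_summand q w (q * U) (q * V) (q * B) (q * C) (j + r) j
      - q ^ Suc (j + r) * tphi_summand q w U V B C (Suc (j + r)) j
    = tphi_cert q w U V B C (j + r) j - (if j = 0 then 0 else tphi_cert q w U V B C (j + r) (j - 1))"
proof (cases j)
  \<comment> \<open>For j > 0 the common factor contains (q U; q)_(j-1) and (q V; q)_(j-1), which
    have no counterpart at j = 0; that index is computed directly.\<close>
  case 0
  define K where "K = q ^ Suc r"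
  have K: "1 - K \<noteq> 0" "K \<noteq> 1"
    using qfact_nonzero[OF q(2), of "Suc r"] unfolding qpoch_Suc K_def by auto
  define X where "X = qpoch (B * q) q r * qpoch (C * q) q r / qpoch q q r"
  have R: "qpoch q q r \<noteq> 0" using qfact_nonzero q by simp
  have Kr: "q ^ r = K / q" using q by (simp add: K_def)
  have 1: "tphi_summand q w (q * U) (q * V) (q * B) (q * C) (Suc r) 0 = X * ((1 - B * K) * (1 - C * K) / (1 - K))"
    by (simp add: tphi_summand_def X_def qpoch_Suc K_def mult_ac)
  have 2: "tphi_summand q w (q * U) (q * V) (q * B) (q * C) r 0 = X"
    by (simp add: tphi_summand_def X_def mult_ac)
  have "qpoch q q (Suc r) = qpoch q q r * (1 - K)" by (simp add: qpoch_Suc K_def)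
  hence 3: "tphi_summand q w U V B C (Suc r) 0 = X * ((1 - B) * (1 - C) / (1 - K))"
    by (simp add: tphi_summand_def X_def qpoch_Suc_front)
  have 4: "tphi_cert q w U V B C r 0 = X * (K * (U * V - 1 / q) * (- w))"
    by (simp add: tphi_cert_def X_def K_def mult_ac qsgn_Suc)
  have 5: "(1 - B * K) * (1 - C * K) / (1 - K) - (1 - w * (K / q)) - K * ((1 - B) * (1 - C) / (1 - K))
      = K * (U * V - 1 / q) * (- w)"
    using K q w apply (simp add: divide_simps) by algebra
  have 6: "X * s - (1 - t) * X - K * (X * u) = X * (s - (1 - t) - K * u)" for s t u
    by (simp add: algebra_simps)
  show ?thesis
    unfolding 0 add_0 1 2 3 4 Kr K_def[symmetric] 6 5 by simp
next
  case (Suc i)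
  define y K where "y = q ^ j" and "K = q ^ Suc (j + r)"
  define X where "X = qsgn q j * w ^ j * qpoch (q * U) q i * qpoch (q * V) q i
     * qpoch (B * (q * y)) q r * qpoch (C * (q * y)) q r / (qpoch q q j * qpoch q q r)"
  have y: "y \<noteq> 0" using q by (simp add: y_def)
  have yi: "q * q ^ i = y" "q ^ i * q = y" by (simp_all add: y_def Suc)
  have KY: "q * q ^ r = K / y" using q by (simp add: K_def y_def power_add)
  have r: "1 - K / y \<noteq> 0"
    using qfact_nonzero[OF q(2), of "Suc r"] unfolding qpoch_Suc KY by simp
  have K1: "q ^ (j + r) = K / q" using q by (simp add: K_def)
  have sd: "Suc (j + r) - j = Suc r" "j + r - j = r" by simp_all
  have sU: "qpoch (q * x) q j = qpoch (q * x) q i * (1 - x * y)" for x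
    unfolding Suc qpoch_Suc yi[symmetric] by (simp add: mult_ac)
  have sU': "qpoch x q j = (1 - x) * qpoch (q * x) q i" for x
    unfolding Suc qpoch_Suc_front by (simp add: mult_ac)
  have sB: "qpoch (q * x * q ^ j) q (Suc r) = qpoch (x * (q * y)) q r * (1 - x * K)" for x
    unfolding qpoch_Suc y_def by (simp add: K_def power_add mult_ac)
  have sB': "qpoch (q * x * q ^ j) q r = qpoch (x * (q * y)) q r" for x
    unfolding y_def by (simp add: mult_ac)
  have sB'': "qpoch (x * q ^ j) q (Suc r) = (1 - x * y) * qpoch (x * (q * y)) q r" for x
    unfolding qpoch_Suc_front y_def by (simp add: mult_ac)
  have sq: "qpoch q q (Suc r) = qpoch q q r * (1 - K / y)" by (simp add: qpoch_Suc KY)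
  have 1: "tphi_summand q w (q * U) (q * V) (q * B) (q * C) (Suc (j + r)) j
      = X * ((1 - U * y) * (1 - V * y) * ((1 - B * K) * (1 - C * K) / (1 - K / y)))"
    unfolding tphi_summand_def sd sU sB sq X_def by (simp add: mult_ac)
  have 2: "tphi_summand q w (q * U) (q * V) (q * B) (q * C) (j + r) j
      = X * ((1 - U * y) * (1 - V * y))"
    unfolding tphi_summand_def sd sU sB' X_def by (simp add: mult_ac)
  have 3: "tphi_summand q w U V B C (Suc (j + r)) j
      = X * ((1 - U) * (1 - V) * (1 - B * y) * (1 - C * y) / (1 - K / y))"
    unfolding tphi_summand_def sd sU'[of U] sU'[of V] sB'' sq X_def by (simp add: mult_ac)
  have 4: "tphi_cert q w U V B C (j + r) j
      = X * (K * (U * V - 1 / (q * y)) * (- y * w) * ((1 - U * y) * (1 - V * y)))"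
    unfolding tphi_cert_def sd sU K_def[symmetric] X_def qsgn_Suc
    unfolding power_Suc y_def[symmetric] by (simp add: mult_ac)
  have "qpoch q q j = qpoch q q i * (1 - y)" by (simp add: Suc y_def qpoch_Suc)
  hence 51: "inverse (qpoch q q i) = (1 - y) / qpoch q q j"
    using qfact_nonzero[OF q(2), of j] qfact_nonzero[OF q(2), of i] by (auto simp: field_simps)
  have sd': "j + r - i = Suc r" using Suc by simp
  have 5: "tphi_cert q w U V B C (j + r) i
      = X * (K * (U * V - 1 / y) * (1 - y) * (1 - B * y) * (1 - C * y) / (1 - K / y))"
  proof -
    have "tphi_cert q w U V B C (j + r) i = K * (U * V - 1 / y) * qsgn q j * w ^ j * qpoch (q * U) q i * qpoch (q * V) q i
       * ((1 - B * y) * qpoch (B * (q * y)) q r) * ((1 - C * y) * qpoch (C * (q * y)) q r)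
       * inverse (qpoch q q i) / (qpoch q q r * (1 - K / y))"
      unfolding tphi_cert_def sd' Suc[symmetric] sB'' sq
      unfolding K_def[symmetric] y_def[symmetric] by (simp add: divide_inverse mult_ac)
    thus ?thesis unfolding 51 X_def by (simp add: mult_ac)
  qed
  have "tphi_summand q w (q * U) (q * V) (q * B) (q * C) (Suc (j + r)) j
      - (1 - w * q ^ (j + r)) * tphi_summand q w (q * U) (q * V) (q * B) (q * C) (j + r) j
      - q ^ Suc (j + r) * tphi_summand q w U V B C (Suc (j + r)) j
    = X * ((1 - U * y) * (1 - V * y) * ((1 - B * K) * (1 - C * K) / (1 - K / y) - (1 - w * (K / q)))
           - K * (1 - U) * (1 - V) * (1 - B * y) * (1 - C * y) / (1 - K / y))"
    unfolding 1 2 3 K1 K_def[symmetric] using r by (simp add: divide_simps algebra_simps)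
  also have "\<dots> = X * (K * (U * V - 1 / (q * y)) * (- y * w) * ((1 - U * y) * (1 - V * y))
           - K * (U * V - 1 / y) * (1 - y) * (1 - B * y) * (1 - C * y) / (1 - K / y))"
    by (subst tphi_cert_identity) (use q y r w in auto)
  finally show ?thesis
    using 4 5 Suc by (simp only: right_diff_distrib if_False nat.distinct diff_Suc_1)
qed

lemma tphi_partial:
  fixes q w U V B C :: complex
  assumes q: "q \<noteq> 0" "norm q < 1" and w: "w * U * V = B * C" and "i \<le> M"
  shows "(\<Sum>j\<le>i. tphi_summand q w (q * U) (q * V) (q * B) (q * C) (Suc M) j
      - (1 - w * q ^ M) * tphi_summand q w (q * U) (q * V) (q * B) (q * C) M j
      - q ^ Suc M * tphi_summand q w U V B C (Suc M) j) = tphi_cert q w U V B C M i"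
  using \<open>i \<le> M\<close>
proof (induction i)
  case 0
  show ?case using tphi_step[OF q w, where j=0 and r=M] by simp
next
  case (Suc i)
  show ?case
    unfolding sum.atMost_Suc Suc.IH[OF Suc_leD[OF Suc.prems]]
    using tphi_step[OF q w, where j="Suc i" and r="M - Suc i"] Suc.prems by simp
qed

lemma tphi_contiguous:
  fixes q w U V B C :: complex
  assumes q: "q \<noteq> 0" "norm q < 1" and w: "w * U * V = B * C"
  shows "tphi q w (q * U) (q * V) (q * B) (q * C) (Suc M)
      = (1 - w * q ^ M) * tphi q w (q * U) (q * V) (q * B) (q * C) M + q ^ Suc M * tphi q w U V B C (Suc M)"
proof -
  define y X where "y = q ^ Suc M" and "X = qsgn q (Suc M) * w ^ Suc M * qpoch (q * U) q M * qpoch (q * V) q M / qpoch q q M"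
  have y: "y \<noteq> 0" using q by (simp add: y_def)
  have sq: "qpoch q q (Suc M) = qpoch q q M * (1 - y)" by (simp add: qpoch_Suc y_def)
  have y1: "1 - y \<noteq> 0" using qfact_nonzero[OF q(2), of "Suc M"] unfolding sq by simp
  have sU: "qpoch (q * x) q (Suc M) = qpoch (q * x) q M * (1 - x * y)" for x
    unfolding qpoch_Suc y_def by (simp add: mult_ac)
  have sU': "qpoch x q (Suc M) = (1 - x) * qpoch (q * x) q M" for x
    unfolding qpoch_Suc_front by (simp add: mult_ac)
  have 1: "tphi_summand q w (q * U) (q * V) (q * B) (q * C) (Suc M) (Suc M) = X * ((1 - U * y) * (1 - V * y) / (1 - y))"
    unfolding tphi_summand_def sU X_def sq by simp
  have 2: "tphi_summand q w U V B C (Suc M) (Suc M) = X * ((1 - U) * (1 - V) / (1 - y))"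
    unfolding tphi_summand_def sU'[of U] sU'[of V] X_def sq by simp
  have 3: "tphi_cert q w U V B C M M = X * (y * (U * V - 1 / y))"
    unfolding tphi_cert_def X_def y_def[symmetric] by simp
  have 4: "(1 - U * y) * (1 - V * y) / (1 - y) - y * ((1 - U) * (1 - V) / (1 - y)) + y * (U * V - 1 / y) = 0"
    using y y1 apply (simp add: divide_simps) by algebra
  \<comment> \<open>Only the two sums of length M + 1 have a term at j = M + 1; their combination
    cancels the boundary value of the certificate.\<close>
  have last: "tphi_summand q w (q * U) (q * V) (q * B) (q * C) (Suc M) (Suc M)
      - y * tphi_summand q w U V B C (Suc M) (Suc M) + tphi_cert q w U V B C M M = 0"
  proof -
    have "tphi_summand q w (q * U) (q * V) (q * B) (q * C) (Suc M) (Suc M)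
      - y * tphi_summand q w U V B C (Suc M) (Suc M) + tphi_cert q w U V B C M M
      = X * ((1 - U * y) * (1 - V * y) / (1 - y) - y * ((1 - U) * (1 - V) / (1 - y)) + y * (U * V - 1 / y))"
      unfolding 1 2 3 by (simp add: algebra_simps)
    thus ?thesis unfolding 4 by simp
  qed
  have "(\<Sum>j\<le>M. tphi_summand q w (q * U) (q * V) (q * B) (q * C) (Suc M) j)
      - (1 - w * q ^ M) * tphi q w (q * U) (q * V) (q * B) (q * C) M
      - y * (\<Sum>j\<le>M. tphi_summand q w U V B C (Suc M) j) = tphi_cert q w U V B C M M"
    unfolding y_def tphi_def sum_distrib_left sum_subtractf[symmetric] by (rule tphi_partial[OF q w order_refl])
  moreover have "s - t - y * u = c \<Longrightarrow> v - y * z + c = 0 \<Longrightarrow> s + v = t + y * (u + z)" for s t u v z c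
  proof -
    assume 1: "s - t - y * u = c" and 2: "v - y * z + c = 0"
    have "s = t + y * u + c" using 1 by (auto simp: algebra_simps)
    moreover have "v = (v - y * z + c) + (y * z - c)" by simp
    hence "v = y * z - c" unfolding 2 by simp
    ultimately show ?thesis by (simp add: algebra_simps)
  qed
  ultimately show ?thesis
    using last unfolding tphi_def[of _ _ _ _ _ _ "Suc M"] sum.atMost_Suc y_def[symmetric] by blast
qed

text \<open>Stated for functions instead of \<open>poly\<close> terms, so that polynomial dependence
  on a parameter follows from the syntactic shape by introduction rules.\<close>

definition is_poly_fun :: "(complex \<Rightarrow> complex) \<Rightarrow> bool" where
  "is_poly_fun f \<longleftrightarrow> (\<exists>p. \<forall>x. f x = poly p x)"

lemma is_poly_fun_const: "is_poly_fun (\<lambda>x. c)"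
  unfolding is_poly_fun_def by (rule exI[of _ "[:c:]"]) simp

lemma is_poly_fun_id: "is_poly_fun (\<lambda>x. x)"
  unfolding is_poly_fun_def by (rule exI[of _ "[:0, 1:]"]) simp

lemma is_poly_fun_add: "is_poly_fun f \<Longrightarrow> is_poly_fun g \<Longrightarrow> is_poly_fun (\<lambda>x. f x + g x)"
  unfolding is_poly_fun_def by (metis poly_add)

lemma is_poly_fun_diff: "is_poly_fun f \<Longrightarrow> is_poly_fun g \<Longrightarrow> is_poly_fun (\<lambda>x. f x - g x)"
  unfolding is_poly_fun_def by (metis poly_diff)

lemma is_poly_fun_mult: "is_poly_fun f \<Longrightarrow> is_poly_fun g \<Longrightarrow> is_poly_fun (\<lambda>x. f x * g x)"
  unfolding is_poly_fun_def by (metis poly_mult)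

lemma is_poly_fun_power: "is_poly_fun f \<Longrightarrow> is_poly_fun (\<lambda>x. f x ^ n)"
  unfolding is_poly_fun_def by (metis poly_power)

lemma is_poly_fun_sum: "(\<And>i. i \<in> I \<Longrightarrow> is_poly_fun (f i)) \<Longrightarrow> is_poly_fun (\<lambda>x. \<Sum>i\<in>I. f i x)"
  by (induction I rule: infinite_finite_induct) (auto intro: is_poly_fun_const is_poly_fun_add)

lemma is_poly_fun_prod: "(\<And>i. i \<in> I \<Longrightarrow> is_poly_fun (f i)) \<Longrightarrow> is_poly_fun (\<lambda>x. \<Prod>i\<in>I. f i x)"
  by (induction I rule: infinite_finite_induct) (auto intro: is_poly_fun_const is_poly_fun_mult)

lemma is_poly_fun_divide_const: "is_poly_fun f \<Longrightarrow> is_poly_fun (\<lambda>x. f x / c)"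
  unfolding divide_inverse by (intro is_poly_fun_mult is_poly_fun_const)

lemmas is_poly_fun_intros = is_poly_fun_const is_poly_fun_id is_poly_fun_add is_poly_fun_diff
  is_poly_fun_mult is_poly_fun_power is_poly_fun_sum is_poly_fun_prod is_poly_fun_divide_const

lemma is_poly_fun_eq_0:
  assumes "is_poly_fun f" "infinite S" "\<And>x. x \<in> S \<Longrightarrow> f x = 0"
  shows "f x = 0"
proof -
  obtain p where p: "\<And>x. f x = poly p x" using assms(1) by (auto simp: is_poly_fun_def)
  have "p = 0"
  proof (rule ccontr)
    assume "p \<noteq> 0"
    hence "finite {x. poly p x = 0}" by (rule poly_roots_finite)
    moreover have "S \<subseteq> {x. poly p x = 0}" using assms(3) p by auto
    ultimately show False using assms(2) finite_subset by blast
  qed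
  thus ?thesis using p by simp
qed

text \<open>Both sides satisfy the contiguous relation linking \<open>q x\<close> to \<open>x\<close> and agree at \<open>x = 1\<close>, hence at all
  \<open>x = q^m\<close>; being polynomials in \<open>x\<close>, they coincide.\<close>

lemma tphi_transformation:
  fixes q w U V B C x :: complex
  assumes q: "q \<noteq> 0" "norm q < 1" and w: "w * U * V = B * C"
  shows "(\<Sum>k\<le>N. qpoch x q (N - k) * x ^ k * qpoch (w * q ^ k) q (N - k) / qpoch q q (N - k) * tphi q w U V B C k)
           = tphi q w (x * U) (x * V) (x * B) (x * C) N"
proof -
  define L where "L = (\<lambda>N x. \<Sum>k\<le>N. qpoch x q (N - k) * x ^ k * qpoch (w * q ^ k) q (N - k) / qpoch q q (N - k) * tphi q w U V B C k)"
  have L_rec: "L (Suc M) (q * x) = (1 - w * q ^ M) * L M (q * x) + q ^ Suc M * L (Suc M) x" for M x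
  proof -
    \<comment> \<open>The recurrence holds coefficientwise in \<open>tphi q w U V B C k\<close>.
      With y = q^(M+1-k) it comes down to 1 - x y = (1 - y) + y (1 - x).\<close>
    have *: "qpoch (q * x) q (Suc M - k) * (q * x) ^ k * qpoch (w * q ^ k) q (Suc M - k) / qpoch q q (Suc M - k)
      = (1 - w * q ^ M) * (qpoch (q * x) q (M - k) * (q * x) ^ k * qpoch (w * q ^ k) q (M - k) / qpoch q q (M - k))
      + q ^ Suc M * (qpoch x q (Suc M - k) * x ^ k * qpoch (w * q ^ k) q (Suc M - k) / qpoch q q (Suc M - k))"
      if k: "k \<le> M" for k
    proof -
      obtain r where M: "M = k + r" using le_Suc_ex[OF k] by blast
      define y t where "y = q ^ Suc r" and "t = q ^ k"
      have sq: "qpoch q q (Suc r) = qpoch q q r * (1 - y)" by (simp add: qpoch_Suc y_def)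
      have y1: "1 - y \<noteq> 0" using qfact_nonzero[OF q(2), of "Suc r"] unfolding sq by simp
      have sd: "Suc M - k = Suc r" "M - k = r" using M by simp_all
      have 1: "qpoch (q * x) q (Suc r) = qpoch (q * x) q r * (1 - x * y)"
        unfolding qpoch_Suc y_def by (simp add: mult_ac)
      have 2: "qpoch x q (Suc r) = qpoch (q * x) q r * (1 - x)"
        unfolding qpoch_Suc_front by (simp add: mult_ac)
      have 3: "qpoch (w * q ^ k) q (Suc r) = qpoch (w * q ^ k) q r * (1 - w * q ^ M)"
        unfolding qpoch_Suc M by (simp add: power_add mult_ac)
      have 4: "q ^ Suc M = y * t" unfolding M y_def t_def by (simp add: power_add)
      have 5: "(1 - x * y) / (1 - y) * t = t + y * t * ((1 - x) / (1 - y))"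
        using y1 apply (simp add: divide_simps) by algebra
      define Z where "Z = qpoch (q * x) q r * x ^ k * qpoch (w * q ^ k) q r * (1 - w * q ^ M) / qpoch q q r"
      have "qpoch (q * x) q (Suc M - k) * (q * x) ^ k * qpoch (w * q ^ k) q (Suc M - k) / qpoch q q (Suc M - k)
          = Z * ((1 - x * y) / (1 - y) * t)"
        unfolding sd 1 3 sq power_mult_distrib Z_def t_def by simp
      moreover have "(1 - w * q ^ M) * (qpoch (q * x) q (M - k) * (q * x) ^ k * qpoch (w * q ^ k) q (M - k) / qpoch q q (M - k)) = Z * t"
        unfolding sd power_mult_distrib Z_def t_def by simp
      moreover have "q ^ Suc M * (qpoch x q (Suc M - k) * x ^ k * qpoch (w * q ^ k) q (Suc M - k) / qpoch q q (Suc M - k))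
          = Z * (y * t * ((1 - x) / (1 - y)))"
        unfolding 4 sd 2 3 sq Z_def by simp
      ultimately show ?thesis unfolding 5 by (simp only: distrib_left)
    qed
    have "L (Suc M) (q * x) = (\<Sum>k\<le>M. (1 - w * q ^ M) * (qpoch (q * x) q (M - k) * (q * x) ^ k * qpoch (w * q ^ k) q (M - k) / qpoch q q (M - k) * tphi q w U V B C k)
      + q ^ Suc M * (qpoch x q (Suc M - k) * x ^ k * qpoch (w * q ^ k) q (Suc M - k) / qpoch q q (Suc M - k) * tphi q w U V B C k))
      + (q * x) ^ Suc M * tphi q w U V B C (Suc M)"
      unfolding L_def sum.atMost_Suc
      \<comment> \<open>The term k = M + 1 is kept apart: it is absent from \<open>L M\<close>, and
        there (q x)^(M+1) supplies the factor q^(M+1) directly.\<close>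
      by (intro arg_cong2[where f="(+)"] sum.cong refl, subst *) (auto simp: algebra_simps)
    also have "\<dots> = (1 - w * q ^ M) * L M (q * x) + q ^ Suc M * L (Suc M) x"
      unfolding L_def sum.atMost_Suc sum.distrib sum_distrib_left[symmetric] distrib_left
      by (simp add: power_mult_distrib mult_ac)
    finally show ?thesis .
  qed
  define D where "D = (\<lambda>N x. L N x - tphi q w (x * U) (x * V) (x * B) (x * C) N)"
  have D_rec: "D (Suc M) (q * x) = (1 - w * q ^ M) * D M (q * x) + q ^ Suc M * D (Suc M) x" for M x
  proof -
    have "tphi q w (q * x * U) (q * x * V) (q * x * B) (q * x * C) (Suc M)
      = (1 - w * q ^ M) * tphi q w (q * x * U) (q * x * V) (q * x * B) (q * x * C) M
        + q ^ Suc M * tphi q w (x * U) (x * V) (x * B) (x * C) (Suc M)"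
      using tphi_contiguous[OF q, of w "x * U" "x * V" "x * B" "x * C" M] w by (simp add: mult_ac)
    thus ?thesis unfolding D_def L_rec by (simp add: algebra_simps)
  qed
  have D_poly: "is_poly_fun (D N)" for N
    unfolding D_def L_def tphi_def tphi_summand_def qpoch_def
    by (intro is_poly_fun_intros)
  have "D N x = 0" for N x
  proof (induction N arbitrary: x)
    case 0
    show ?case by (simp add: D_def L_def tphi_def tphi_summand_def)
  next
    case (Suc M)
    \<comment> \<open>Since \<open>D M\<close> vanishes identically by the outer induction,
      \<open>D_rec\<close> carries a zero at q^m over to q^(m+1).\<close>
    have "D (Suc M) (q ^ m) = 0" for m
    proof (induction m)
      case 0
      \<comment> \<open>At x = 1 the factor (x; q)_(N-k) kills every term except k = N.\<close>
      have "L (Suc M) 1 = tphi q w U V B C (Suc M)"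
        unfolding L_def by (subst sum.remove[of _ "Suc M"]) (auto simp: qpoch_1_left intro!: sum.neutral)
      thus ?case by (simp add: D_def)
    next
      case (Suc m)
      thus ?case using D_rec[of M "q ^ m"] \<open>\<And>x. D M x = 0\<close> by simp
    qed
    moreover have "infinite (range (\<lambda>m. q ^ m))"
    proof (rule range_inj_infinite)
      show "inj (\<lambda>m. q ^ m)"
      proof (rule injI)
        fix m n assume "q ^ m = q ^ n"
        hence "norm q ^ m = norm q ^ n" by (metis norm_power)
        thus "m = n" using q power_inject_exp'[of "norm q" m n] by simp
      qed
    qed
    ultimately show ?case using is_poly_fun_eq_0[OF D_poly] by (metis rangeE)
  qed
  thus ?thesis by (simp add: D_def L_def)
qed

subsection \<open>The terminating case\<close>

text \<open>In a 3-phi-2 the power of (-1)^n q^(n(n-1)/2) has exponent 0, so \<open>qsgn\<close>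
  arises only from (q^-k; q)_j through \<open>qpoch_neg_power\<close>. The q^(k j) of the argument
  cancels there, and (B; q)_k / (B; q)_j becomes the tail factor of
  \<open>tphi_summand\<close>.\<close>

lemma qphi_terminating:
  assumes q: "q \<noteq> 0" "norm q < 1" and BC: "qpoch B q k \<noteq> 0" "qpoch C q k \<noteq> 0"
  shows "qpoch B q k * qpoch C q k * qphi [1 / q ^ k, U, V] [B, C] q (w * q ^ k)
           = qpoch q q k * tphi q w U V B C k"
proof -
  have "qphi [1 / q ^ k, U, V] [B, C] q (w * q ^ k)
      = (\<Sum>j\<le>k. qphi_term [1 / q ^ k, U, V] [B, C] q (w * q ^ k) j)"
    unfolding qphi_def
    by (rule suminf_finite) (use q in \<open>auto simp: qphi_term_def qpochs_def qpoch_neg_power_eq_0\<close>)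
  moreover have "qpoch B q k * qpoch C q k * qphi_term [1 / q ^ k, U, V] [B, C] q (w * q ^ k) j
      = qpoch q q k * tphi_summand q w U V B C k j" if j: "j \<le> k" for j
  proof -
    obtain r where k: "k = j + r" using le_Suc_ex[OF j] by blast
    have nz: "qpoch q q r \<noteq> 0" "q ^ (k * j) \<noteq> 0" using q qfact_nonzero by auto
    have 1: "qpoch (1 / q ^ k) q j = qsgn q j * qpoch q q k / (q ^ (k * j) * qpoch q q r)"
      using qpoch_neg_power[OF q(1), of j r] nz unfolding k by (simp add: field_simps)
    have 2: "qpoch x q k / qpoch x q j = qpoch (x * q ^ j) q r" if "qpoch x q k \<noteq> 0" for x
      using that unfolding k qpoch_add by auto
    have "qpoch B q k * qpoch C q k * qphi_term [1 / q ^ k, U, V] [B, C] q (w * q ^ k) j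
      = qpoch (1 / q ^ k) q j * q ^ (k * j) * qpoch U q j * qpoch V q j
        * (qpoch B q k / qpoch B q j) * (qpoch C q k / qpoch C q j) * w ^ j / qpoch q q j"
      by (simp add: qphi_term_def qpochs_def power_mult_distrib power_mult[symmetric] divide_inverse mult_ac)
    also have "\<dots> = qpoch q q k * tphi_summand q w U V B C k j"
      unfolding 1 2[OF BC(1)] 2[OF BC(2)] tphi_summand_def
      using nz by (simp add: k divide_inverse mult_ac)
    finally show ?thesis .
  qed
  ultimately show ?thesis
    by (simp add: tphi_def sum_distrib_left)
qed

text \<open>The left side as a double series: the outer factor is moved inside, ready for exchanging
  the two summations.\<close>

definition lhs_summand ::
  "complex \<Rightarrow> complex \<Rightarrow> complex \<Rightarrow> complex \<Rightarrow> complex \<Rightarrow> complex \<Rightarrow> complex \<Rightarrow> complex \<Rightarrow> complex \<Rightarrow> nat \<Rightarrow> nat \<Rightarrow> complex" where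
  "lhs_summand q \<alpha> a b c \<beta> \<gamma> u v n k =
     (1 - \<alpha> * q ^ (2 * n)) * qpochs [\<alpha>, q / a, q / b, q / c] q n
       / ((1 - \<alpha>) * qpochs [q, \<alpha> * a, \<alpha> * b, \<alpha> * c] q n)
     * (\<alpha> * a * b * c / q ^ 2) ^ n
     * (qpochs [1 / q ^ n, \<alpha> * q ^ n, \<beta>, \<gamma>] q k * q ^ k
                  / qpochs [q, q / a, q / b, \<beta> * \<gamma> * u * v] q k
                  * qphi [1 / q ^ k, 1 / u, 1 / v] [\<beta>, \<gamma>] q (\<beta> * \<gamma> * u * v * q ^ k))"

text \<open>For c = q^(N+1) the factor (q/c; q)_n is (q^-N; q)_n. With n = k + m, the dependence on
  m at fixed k is that of a very-well-poised 6-phi-5 of length N - k whose parameters are shifted by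
  powers q^(2k), q^k, q^k.\<close>

lemma lhs_summand_terminating:
  fixes q \<alpha> a b \<beta> \<gamma> u v :: complex
  assumes q: "q \<noteq> 0" "norm q < 1" and nz: "a \<noteq> 0" "b \<noteq> 0"
    and den: "\<And>n. qpoch (\<alpha> * a) q n \<noteq> 0" "\<And>n. qpoch (\<alpha> * b) q n \<noteq> 0"
      "\<And>n. qpoch (q / a) q n \<noteq> 0" "\<And>n. qpoch (q / b) q n \<noteq> 0"
      "\<And>n. qpoch \<beta> q n \<noteq> 0" "\<And>n. qpoch \<gamma> q n \<noteq> 0" "\<And>n. qpoch (\<alpha> * q ^ Suc N) q n \<noteq> 0"
    and N: "N = k + m + r"
  shows "lhs_summand q \<alpha> a b (q ^ Suc N) \<beta> \<gamma> u v (k + m) k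
    = qpoch q q N * qpoch \<alpha> q (2 * k) * (\<alpha> * a * b / q) ^ k * tphi q (\<beta> * \<gamma> * u * v) (1 / u) (1 / v) \<beta> \<gamma> k
      / ((1 - \<alpha>) * qpoch (\<alpha> * a) q N * qpoch (\<alpha> * b) q N * qpoch (\<alpha> * q ^ Suc N) q N * qpoch (\<beta> * \<gamma> * u * v) q k)
      * sixphi5_summand q (\<alpha> * q ^ (2 * k)) (q / a * q ^ k) (q / b * q ^ k) (m + r) m"
proof -
  define n w x A B C where "n = k + m" and "w = \<beta> * \<gamma> * u * v" and "x = \<alpha> * a * b / q"
    and "A = \<alpha> * q ^ (2 * k)" and "B = q / a * q ^ k" and "C = q / b * q ^ k"
  define G where "G = qphi [1 / q ^ k, 1 / u, 1 / v] [\<beta>, \<gamma>] q (w * q ^ k)"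
  have qf: "qpoch q q i \<noteq> 0" for i using qfact_nonzero q by simp
  \<comment> \<open>Both sides are (\<alpha>; q)_(n+k), cut at n on the left and at 2k on the
    right.\<close>
  have g1: "qpoch \<alpha> q n * qpoch (\<alpha> * q ^ n) q k = qpoch \<alpha> q (2 * k) * qpoch A q m"
    unfolding A_def qpoch_add[symmetric] by (simp add: n_def mult_2 add_ac)
  have g2: "qpoch (q / a) q n / qpoch (q / a) q k = qpoch B q m"
    unfolding n_def B_def qpoch_add using den by simp
  have g3: "qpoch (q / b) q n / qpoch (q / b) q k = qpoch C q m"
    unfolding n_def C_def qpoch_add using den by simp
  have qc: "q / q ^ Suc N = 1 / q ^ N" using q by simp
  have Nn: "N = n + r" by (simp add: N n_def)
  have Z: "(\<alpha> * a * b * q ^ Suc N / q ^ 2) ^ n = x ^ n * q ^ (N * n)"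
  proof -
    have "\<alpha> * a * b * q ^ Suc N / q ^ 2 = x * q ^ N" using q by (simp add: x_def power2_eq_square)
    thus ?thesis by (simp add: power_mult_distrib power_mult)
  qed
  have "qsgn q n * qsgn q k * q ^ k = (qsgn q k * qsgn q k * q ^ k) * qsgn q m * q ^ (k * m)"
    by (simp add: n_def qsgn_add mult_ac)
  also have "\<dots> = q ^ (n * k) * qsgn q m"
    unfolding qsgn_square by (simp add: n_def power_add[symmetric] algebra_simps)
  finally have sg: "qsgn q n * qsgn q k * q ^ k = q ^ (n * k) * qsgn q m" .
  \<comment> \<open>Here all signs and powers of q meet: q^(N n) from c^n cancels against (q^-N;
    q)_n, and \<open>sg\<close> absorbs q^(n k) from (q^-n; q)_k, leaving only
    \<open>qsgn q m\<close>.\<close>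
  have g4: "qpoch (q / q ^ Suc N) q n * (\<alpha> * a * b * q ^ Suc N / q ^ 2) ^ n * qpoch (1 / q ^ n) q k * q ^ k / qpoch q q n
      = qsgn q m * x ^ n * qpoch q q N / (qpoch q q r * qpoch q q m)"
  proof -
    have 1: "qpoch (1 / q ^ N) q n * q ^ (N * n) = qsgn q n * qpoch q q N / qpoch q q r"
      using qpoch_neg_power[OF q(1), of n r] qf[of r] unfolding Nn by (simp add: field_simps)
    have 2: "qpoch (1 / q ^ n) q k = qsgn q k * qpoch q q n / (q ^ (n * k) * qpoch q q m)"
      using qpoch_neg_power[OF q(1), of k m] qf[of m] q unfolding n_def by (simp add: field_simps)
    have "qpoch (q / q ^ Suc N) q n * (\<alpha> * a * b * q ^ Suc N / q ^ 2) ^ n * qpoch (1 / q ^ n) q k * q ^ k / qpoch q q n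
      = x ^ n * (qpoch (1 / q ^ N) q n * q ^ (N * n)) * qpoch (1 / q ^ n) q k * q ^ k / qpoch q q n"
      unfolding qc Z by (simp add: mult_ac)
    also have "\<dots> = x ^ n * (qsgn q n * qsgn q k * q ^ k) * qpoch q q N / (qpoch q q r * qpoch q q m) / q ^ (n * k)"
      unfolding 1 2 using qf[of n] by (simp add: divide_inverse mult_ac)
    also have "\<dots> = qsgn q m * x ^ n * qpoch q q N / (qpoch q q r * qpoch q q m)"
      unfolding sg using q by (simp add: mult_ac)
    finally show ?thesis .
  qed
  \<comment> \<open>Denominators of length n are extended to length N, hence made independent of m,
    at the price of the tail factors in \<open>sixphi5_summand\<close>.\<close>
  have g5: "inverse (qpoch y q n) = qpoch (y * q ^ n) q r / qpoch y q N" if "\<And>i. qpoch y q i \<noteq> 0" for y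
    unfolding Nn qpoch_add using that[of n] that[of N, unfolded Nn qpoch_add] by (simp add: field_simps)
  have g6: "qpoch \<beta> q k * qpoch \<gamma> q k * G / qpoch q q k = tphi q w (1 / u) (1 / v) \<beta> \<gamma> k"
    unfolding G_def using qphi_terminating[OF q, of \<beta> k \<gamma> "1 / u" "1 / v" w] den qf[of k] by simp
  have "lhs_summand q \<alpha> a b (q ^ Suc N) \<beta> \<gamma> u v n k
     = (1 - \<alpha> * q ^ (2 * n)) / (1 - \<alpha>) * (qpoch \<alpha> q n * qpoch (\<alpha> * q ^ n) q k)
       * (qpoch (q / a) q n / qpoch (q / a) q k) * (qpoch (q / b) q n / qpoch (q / b) q k)
       * (qpoch (q / q ^ Suc N) q n * (\<alpha> * a * b * q ^ Suc N / q ^ 2) ^ n * qpoch (1 / q ^ n) q k * q ^ k / qpoch q q n)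
       * inverse (qpoch (\<alpha> * a) q n) * inverse (qpoch (\<alpha> * b) q n) * inverse (qpoch (\<alpha> * q ^ Suc N) q n)
       * (qpoch \<beta> q k * qpoch \<gamma> q k * G / qpoch q q k) / qpoch w q k"
    unfolding lhs_summand_def G_def[symmetric] w_def[symmetric] qpochs_def list.map prod_list.Cons prod_list.Nil
      mult_1_right
    unfolding divide_inverse inverse_mult_distrib by (simp only: mult_ac)
  also have "\<dots> = (1 - \<alpha> * q ^ (2 * n)) / (1 - \<alpha>) * (qpoch \<alpha> q (2 * k) * qpoch A q m)
       * qpoch B q m * qpoch C q m
       * (qsgn q m * x ^ n * qpoch q q N / (qpoch q q r * qpoch q q m))
       * (qpoch (\<alpha> * a * q ^ n) q r / qpoch (\<alpha> * a) q N) * (qpoch (\<alpha> * b * q ^ n) q r / qpoch (\<alpha> * b) q N)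
       * (qpoch (\<alpha> * q ^ Suc N * q ^ n) q r / qpoch (\<alpha> * q ^ Suc N) q N)
       * tphi q w (1 / u) (1 / v) \<beta> \<gamma> k / qpoch w q k"
    unfolding g1 g2 g3 g4 g5[OF den(1)] g5[OF den(2)] g5[OF den(7)] g6 ..
  also have "\<dots> = qpoch q q N * qpoch \<alpha> q (2 * k) * x ^ k * tphi q w (1 / u) (1 / v) \<beta> \<gamma> k
      / ((1 - \<alpha>) * qpoch (\<alpha> * a) q N * qpoch (\<alpha> * b) q N * qpoch (\<alpha> * q ^ Suc N) q N * qpoch w q k)
      * sixphi5_summand q A B C (m + r) m"
  proof -
    have h1: "\<alpha> * q ^ (2 * n) = A * q ^ (2 * m)"
      by (simp add: A_def n_def power_add algebra_simps)
    have h2: "x ^ n = x ^ k * x ^ m" by (simp add: n_def power_add)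
    have h3: "\<alpha> * a * q ^ n = A * q / B * q ^ m" "\<alpha> * b * q ^ n = A * q / C * q ^ m"
      using q nz by (simp_all add: A_def B_def C_def n_def power_add mult_2 mult_2_right field_simps)
    have h4: "\<alpha> * q ^ Suc N * q ^ n = A * q ^ (m + r + 1 + m)"
      by (simp add: A_def n_def N power_add mult_2 mult_2_right mult_ac)
    have h5: "A * q / (B * C) = x"
      using q nz by (simp add: A_def B_def C_def x_def power_add mult_2 mult_2_right field_simps)
    have h6: "m + r - m = r" by simp
    show ?thesis
      unfolding h1 h2 h3 h4 sixphi5_summand_def h5 h6
      unfolding divide_inverse inverse_mult_distrib by (simp only: mult_ac)
  qed
  finally show ?thesis by (simp only: n_def w_def x_def A_def B_def C_def)
qed

text \<open>The exchanged sum over m is evaluated by \<open>sixphi5_sum\<close>; the remaining sum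
  over k is exactly the left side of \<open>tphi_transformation\<close>.\<close>

lemma lhs_terminating:
  fixes q \<alpha> a b \<beta> \<gamma> u v :: complex
  assumes q: "q \<noteq> 0" "norm q < 1" and nz: "a \<noteq> 0" "b \<noteq> 0" "u \<noteq> 0" "v \<noteq> 0" "\<alpha> \<noteq> 1"
    and den: "\<And>n. qpoch (\<alpha> * a) q n \<noteq> 0" "\<And>n. qpoch (\<alpha> * b) q n \<noteq> 0"
      "\<And>n. qpoch (q / a) q n \<noteq> 0" "\<And>n. qpoch (q / b) q n \<noteq> 0"
      "\<And>n. qpoch \<beta> q n \<noteq> 0" "\<And>n. qpoch \<gamma> q n \<noteq> 0" "\<And>n. qpoch (\<alpha> * q ^ Suc N) q n \<noteq> 0"
      "\<And>n. qpoch (\<beta> * \<gamma> * u * v) q n \<noteq> 0"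
  defines "x \<equiv> \<alpha> * a * b / q" and "w \<equiv> \<beta> * \<gamma> * u * v"
  shows "(\<Sum>n. lhs_term q \<alpha> a b (q ^ Suc N) \<beta> \<gamma> u v n)
     = qpoch q q N * qpoch (q * \<alpha>) q N / (qpoch (\<alpha> * a) q N * qpoch (\<alpha> * b) q N * qpoch w q N)
       * tphi q w (x / u) (x / v) (x * \<beta>) (x * \<gamma>) N"
proof -
  let ?H = "lhs_summand q \<alpha> a b (q ^ Suc N) \<beta> \<gamma> u v"
  define c0 where "c0 = qpoch q q N * qpoch (q * \<alpha>) q N / (qpoch (\<alpha> * a) q N * qpoch (\<alpha> * b) q N * qpoch w q N)"
  have lhs: "lhs_term q \<alpha> a b (q ^ Suc N) \<beta> \<gamma> u v n = (\<Sum>k\<le>n. ?H n k)" for n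
    unfolding lhs_term_def lhs_summand_def sum_distrib_left ..
  have "(\<Sum>n. lhs_term q \<alpha> a b (q ^ Suc N) \<beta> \<gamma> u v n) = (\<Sum>n\<le>N. lhs_term q \<alpha> a b (q ^ Suc N) \<beta> \<gamma> u v n)"
  proof (rule suminf_finite)
    fix n assume "n \<notin> {..N}"
    moreover have "q / q ^ Suc N = 1 / q ^ N" using q by simp
    ultimately have "qpoch (q / q ^ Suc N) q n = 0" using qpoch_neg_power_eq_0[OF q(1)] by simp
    thus "lhs_term q \<alpha> a b (q ^ Suc N) \<beta> \<gamma> u v n = 0" by (simp add: lhs_term_def qpochs_def)
  qed simp
  also have "\<dots> = (\<Sum>k\<le>N. \<Sum>m\<le>N - k. ?H (k + m) k)"
    \<comment> \<open>The triangle k \<le> n \<le> N is reindexed by n = k + m.\<close>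
    unfolding lhs by (subst (1 2) sum.Sigma) (auto intro!: sum.reindex_bij_witness[of _ "\<lambda>(k, m). (k + m, k)" "\<lambda>(n, k). (k, n - k)"])
  also have "\<dots> = (\<Sum>k\<le>N. c0 * (qpoch x q (N - k) * x ^ k * qpoch (w * q ^ k) q (N - k) / qpoch q q (N - k)
      * tphi q w (1 / u) (1 / v) \<beta> \<gamma> k))"
  proof (rule sum.cong[OF refl])
    fix k assume "k \<in> {..N}"
    hence kN: "k \<le> N" by simp
    define P where "P = qpoch q q N * qpoch \<alpha> q (2 * k) * x ^ k * tphi q w (1 / u) (1 / v) \<beta> \<gamma> k
      / ((1 - \<alpha>) * qpoch (\<alpha> * a) q N * qpoch (\<alpha> * b) q N * qpoch (\<alpha> * q ^ Suc N) q N * qpoch w q k)"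
    have "?H (k + m) k = P * sixphi5_summand q (\<alpha> * q ^ (2 * k)) (q / a * q ^ k) (q / b * q ^ k) (N - k) m"
      if "m \<le> N - k" for m
      using lhs_summand_terminating[OF q nz(1,2) den(1-7), where k=k and m=m and r="N - k - m" and u=u and v=v] kN that
      unfolding P_def x_def w_def by simp
    hence "(\<Sum>m\<le>N - k. ?H (k + m) k)
        = P * (\<Sum>m\<le>N - k. sixphi5_summand q (\<alpha> * q ^ (2 * k)) (q / a * q ^ k) (q / b * q ^ k) (N - k) m)"
      unfolding sum_distrib_left by (intro sum.cong) auto
    also have "\<dots> = P * (qpoch (\<alpha> * q ^ (2 * k)) q (2 * (N - k) + 1) * qpoch x q (N - k) / qpoch q q (N - k))"
    proof -
      \<comment> \<open>The powers of q^k cancel, so the inner sum produces the same x for every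
        k.\<close>
      have "\<alpha> * q ^ (2 * k) * q / (q / a * q ^ k * (q / b * q ^ k)) = x"
        using q nz by (simp add: x_def mult_2 mult_2_right power_add field_simps)
      thus ?thesis using q nz by (subst sixphi5_sum[OF q]) simp_all
    qed
    also have "\<dots> = c0 * (qpoch x q (N - k) * x ^ k * qpoch (w * q ^ k) q (N - k) / qpoch q q (N - k)
      * tphi q w (1 / u) (1 / v) \<beta> \<gamma> k)"
    proof -
      \<comment> \<open>The two pieces join to (\<alpha>; q)_(2N+1), which no longer depends on k;
        splitting it again cancels 1 - \<alpha> and (\<alpha> q^(N+1); q)_N from the
        denominator.\<close>
      have "qpoch \<alpha> q (2 * k) * qpoch (\<alpha> * q ^ (2 * k)) q (2 * (N - k) + 1) = qpoch \<alpha> q (Suc (N + N))"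
        unfolding qpoch_add[symmetric] using kN by (intro arg_cong[where f="qpoch \<alpha> q"]) simp
      also have "\<dots> = (1 - \<alpha>) * qpoch (q * \<alpha>) q N * qpoch (\<alpha> * q ^ Suc N) q N"
        unfolding qpoch_Suc_front qpoch_add by (simp add: mult_ac)
      finally have 1: "qpoch \<alpha> q (2 * k) * qpoch (\<alpha> * q ^ (2 * k)) q (2 * (N - k) + 1)
        = (1 - \<alpha>) * qpoch (q * \<alpha>) q N * qpoch (\<alpha> * q ^ Suc N) q N" .
      have 2: "inverse (qpoch w q k) = qpoch (w * q ^ k) q (N - k) / qpoch w q N"
        using qpoch_add[of w q k "N - k"] kN den(8)[folded w_def, of k] den(8)[folded w_def, of N]
        by (simp add: field_simps)
      have "P * (qpoch (\<alpha> * q ^ (2 * k)) q (2 * (N - k) + 1) * qpoch x q (N - k) / qpoch q q (N - k))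
        = qpoch q q N * (qpoch \<alpha> q (2 * k) * qpoch (\<alpha> * q ^ (2 * k)) q (2 * (N - k) + 1))
          * x ^ k * tphi q w (1 / u) (1 / v) \<beta> \<gamma> k
          * inverse ((1 - \<alpha>) * qpoch (\<alpha> * a) q N * qpoch (\<alpha> * b) q N * qpoch (\<alpha> * q ^ Suc N) q N)
          * inverse (qpoch w q k) * qpoch x q (N - k) / qpoch q q (N - k)"
        unfolding P_def divide_inverse inverse_mult_distrib by (simp only: mult_ac)
      also have "\<dots> = c0 * (qpoch x q (N - k) * x ^ k * qpoch (w * q ^ k) q (N - k) / qpoch q q (N - k)
        * tphi q w (1 / u) (1 / v) \<beta> \<gamma> k)"
        unfolding 1 2 c0_def using nz(5) den(7)[of N] by (simp add: divide_inverse mult_ac)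
      finally show ?thesis .
    qed
    finally show "(\<Sum>m\<le>N - k. ?H (k + m) k) = c0 * (qpoch x q (N - k) * x ^ k * qpoch (w * q ^ k) q (N - k) / qpoch q q (N - k)
      * tphi q w (1 / u) (1 / v) \<beta> \<gamma> k)" .
  qed
  also have "\<dots> = c0 * tphi q w (x * (1 / u)) (x * (1 / v)) (x * \<beta>) (x * \<gamma>) N"
    unfolding sum_distrib_left[symmetric]
    by (subst tphi_transformation[OF q]) (use nz in \<open>simp_all add: w_def\<close>)
  finally show ?thesis by (simp add: c0_def)
qed

subsection \<open>Analytic dependence on \<open>c\<close>\<close>

lemma prod_one_plus_geometric_le:
  fixes s t :: real
  assumes "0 \<le> t" "0 \<le> s" "s < 1"
  shows "(\<Prod>k<n. 1 + t * s ^ k) \<le> exp (t / (1 - s))"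
proof -
  have "(\<Prod>k<n. 1 + t * s ^ k) \<le> (\<Prod>k<n. exp (t * s ^ k))"
    using assms by (intro prod_mono) (auto intro: exp_ge_add_one_self add_nonneg_nonneg)
  also have "\<dots> = exp (t * (\<Sum>k<n. s ^ k))"
    by (simp add: exp_sum sum_distrib_left)
  also have "(\<Sum>k<n. s ^ k) \<le> (\<Sum>k. s ^ k)"
    using assms by (intro sum_le_suminf summable_geometric) auto
  hence "exp (t * (\<Sum>k<n. s ^ k)) \<le> exp (t / (1 - s))"
    using assms mult_left_mono[of "\<Sum>k<n. s ^ k" "1 / (1 - s)" t] by (simp add: suminf_geometric)
  finally show ?thesis .
qed

lemma norm_qpoch_le:
  assumes "norm q < 1"
  shows "norm (qpoch x q n) \<le> exp (norm x / (1 - norm q))"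
proof -
  have "norm (qpoch x q n) = (\<Prod>k<n. norm (1 - x * q ^ k))"
    by (simp add: qpoch_def prod_norm)
  also have "\<dots> \<le> (\<Prod>k<n. 1 + norm x * norm q ^ k)"
  proof (intro prod_mono conjI norm_ge_zero)
    show "norm (1 - x * q ^ k) \<le> 1 + norm x * norm q ^ k" for k
      using norm_triangle_ineq4[of 1 "x * q ^ k"] by (simp add: norm_mult norm_power)
  qed
  also have "\<dots> \<le> exp (norm x / (1 - norm q))"
    using assms by (intro prod_one_plus_geometric_le) auto
  finally show ?thesis .
qed

lemma convergent_prod_qpoch:
  fixes q x :: complex
  assumes "norm q < 1"
  shows "convergent_prod (\<lambda>k. 1 - x * q ^ k)"
proof -
  have "summable (\<lambda>k. norm x * norm q ^ k)"
    using assms by (intro summable_mult summable_geometric) auto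
  hence "abs_convergent_prod (\<lambda>k. 1 - x * q ^ k)"
    by (simp add: abs_convergent_prod_conv_summable norm_mult norm_power)
  thus ?thesis by (rule abs_convergent_prod_imp_convergent_prod)
qed

lemma qpoch_LIMSEQ:
  assumes "norm q < 1"
  shows "(\<lambda>n. qpoch x q n) \<longlonglongrightarrow> qpoch_inf x q"
proof -
  have "(\<lambda>n. \<Prod>k\<le>n. 1 - x * q ^ k) \<longlonglongrightarrow> qpoch_inf x q"
    unfolding qpoch_inf_def by (rule convergent_prod_LIMSEQ[OF convergent_prod_qpoch[OF assms]])
  hence "(\<lambda>n. qpoch x q (Suc n)) \<longlonglongrightarrow> qpoch_inf x q"
    by (simp add: qpoch_def lessThan_Suc_atMost del: prod.lessThan_Suc)
  thus ?thesis by (rule LIMSEQ_imp_Suc)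
qed

lemma qpoch_inf_split:
  assumes "norm q < 1"
  shows "qpoch_inf x q = qpoch x q n * qpoch_inf (x * q ^ n) q"
proof (rule LIMSEQ_unique)
  show "(\<lambda>m. qpoch x q (n + m)) \<longlonglongrightarrow> qpoch_inf x q"
    using LIMSEQ_ignore_initial_segment[OF qpoch_LIMSEQ[OF assms, of x], of n] by (simp add: add.commute)
  have "(\<lambda>m. qpoch x q n * qpoch (x * q ^ n) q m) \<longlonglongrightarrow> qpoch x q n * qpoch_inf (x * q ^ n) q"
    by (intro tendsto_mult tendsto_const qpoch_LIMSEQ assms)
  thus "(\<lambda>m. qpoch x q (n + m)) \<longlonglongrightarrow> qpoch x q n * qpoch_inf (x * q ^ n) q"
    by (simp add: qpoch_add)
qed

lemma qpoch_nonzero: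
  assumes "norm q < 1" "qpoch_inf x q \<noteq> 0"
  shows "qpoch x q n \<noteq> 0"
  using qpoch_inf_split[OF assms(1), of x n] assms(2) by auto

lemma qpoch_inf_nonzero:
  assumes "norm q < 1" "\<And>k. x * q ^ k \<noteq> 1"
  shows "qpoch_inf x q \<noteq> 0"
  unfolding qpoch_inf_def
  using assms by (intro prodinf_nonzero convergent_prod_qpoch) auto

lemma qpoch_inf_nonzero_of_norm_less:
  assumes "norm q < 1" "norm x < 1"
  shows "qpoch_inf x q \<noteq> 0"
proof (rule qpoch_inf_nonzero[OF assms(1)])
  fix k
  have "norm (x * q ^ k) \<le> norm x * 1"
    using assms by (simp only: norm_mult norm_power) (intro mult_left_mono power_le_one, auto)
  thus "x * q ^ k \<noteq> 1" using assms by auto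
qed

lemma norm_qpoch_inf_le:
  assumes "norm q < 1"
  shows "norm (qpoch_inf x q) \<le> exp (norm x / (1 - norm q))"
  by (rule LIMSEQ_le_const2[OF tendsto_norm[OF qpoch_LIMSEQ[OF assms]]])
     (use norm_qpoch_le[OF assms] in blast)

text \<open>The partial products are polynomials in x and converge uniformly on each closed unit
  disc, by comparison with a geometric series.\<close>

lemma holomorphic_qpoch_inf:
  assumes q: "norm q < 1"
  shows "(\<lambda>x. qpoch_inf x q) holomorphic_on UNIV"
proof (rule holomorphic_uniform_sequence[OF open_UNIV])
  show "(\<lambda>x. qpoch x q n) holomorphic_on UNIV" for n
    unfolding qpoch_def by (intro holomorphic_intros)
next
  fix x :: complex
  let ?A = "cball x 1"
  have "uniformly_convergent_on ?A (\<lambda>N x. \<Prod>k<N. 1 + - (x * q ^ k))"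
  proof (rule uniformly_convergent_on_prod)
    show "uniformly_convergent_on ?A (\<lambda>N y. \<Sum>n<N. norm (- (y * q ^ n)))"
    proof (rule Weierstrass_m_test'[where M = "\<lambda>n. (norm x + 1) * norm q ^ n"])
      fix n y assume "y \<in> ?A"
      hence "norm y \<le> norm x + 1"
        using norm_triangle_sub[of y x] by (simp add: dist_norm norm_minus_commute)
      thus "norm (norm (- (y * q ^ n))) \<le> (norm x + 1) * norm q ^ n"
        by (simp add: norm_mult norm_power mult_right_mono)
    next
      show "summable (\<lambda>n. (norm x + 1) * norm q ^ n)"
        using q by (intro summable_mult summable_geometric) auto
    qed
  qed (auto intro!: continuous_intros)
  hence "uniformly_convergent_on ?A (\<lambda>N x. qpoch x q N)"
    by (simp add: qpoch_def)
  hence "uniform_limit ?A (\<lambda>N x. qpoch x q N) (\<lambda>x. lim (\<lambda>N. qpoch x q N)) sequentially"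
    by (simp add: uniformly_convergent_uniform_limit_iff)
  hence "uniform_limit ?A (\<lambda>N x. qpoch x q N) (\<lambda>x. qpoch_inf x q) sequentially"
    by (simp add: limI[OF qpoch_LIMSEQ[OF q]])
  thus "\<exists>d>0. cball x d \<subseteq> UNIV \<and> uniform_limit (cball x d) (\<lambda>n x. qpoch x q n) (\<lambda>x. qpoch_inf x q) sequentially"
    by (intro exI[of _ 1]) auto
qed

lemma holomorphic_qpoch_inf' [holomorphic_intros]:
  assumes "norm q < 1" "f holomorphic_on S"
  shows "(\<lambda>x. qpoch_inf (f x) q) holomorphic_on S"
  using holomorphic_on_compose_gen[OF assms(2) holomorphic_qpoch_inf[OF assms(1)]]
  by (simp add: o_def)

text \<open>The homogenised form \<open>c^n (q/c; q)_n\<close>, a polynomial in \<open>c\<close>.\<close>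

definition qshift :: "complex \<Rightarrow> complex \<Rightarrow> nat \<Rightarrow> complex" where
  "qshift q c n = (\<Prod>k<n. c - q ^ Suc k)"

lemma qshift_eq: "c \<noteq> 0 \<Longrightarrow> qshift q c n = qpoch (q / c) q n * c ^ n"
  by (induction n) (simp_all add: qshift_def qpoch_Suc field_simps)

text \<open>Each factor is at most r (1 + |q|^(k+1) / r). The resulting constant is independent of n
  and c, which is what a Weierstrass test on the closed disc requires.\<close>

lemma norm_qshift_le:
  assumes "norm q < 1" "norm c \<le> r" "0 < r"
  shows "norm (qshift q c n) \<le> exp (norm q / r / (1 - norm q)) * r ^ n"
proof -
  have "norm (qshift q c n) = (\<Prod>k<n. norm (c - q ^ Suc k))"
    by (simp add: qshift_def prod_norm)
  also have "\<dots> \<le> (\<Prod>k<n. (1 + norm q / r * norm q ^ k) * r)"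
  proof (intro prod_mono conjI norm_ge_zero)
    fix k
    have "norm (c - q ^ Suc k) \<le> r + norm q ^ Suc k"
      using norm_triangle_ineq4[of c "q ^ Suc k"] assms by (simp add: norm_mult norm_power)
    also have "\<dots> = (1 + norm q / r * norm q ^ k) * r"
      using assms by (simp add: field_simps)
    finally show "norm (c - q ^ Suc k) \<le> (1 + norm q / r * norm q ^ k) * r" .
  qed
  also have "\<dots> = (\<Prod>k<n. 1 + norm q / r * norm q ^ k) * r ^ n"
    by (simp add: prod.distrib)
  also have "\<dots> \<le> exp (norm q / r / (1 - norm q)) * r ^ n"
    using assms by (intro mult_right_mono prod_one_plus_geometric_le) auto
  finally show ?thesis .
qed

text \<open>The majorant is a constant times |T n| r^n. The test includes the boundary circle, where
  the given c will lie; g n leaves room for the infinite product that remains after clearing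
  (\<alpha> c; q)_n.\<close>

lemma qshift_series:
  fixes T :: "nat \<Rightarrow> complex" and g :: "nat \<Rightarrow> complex \<Rightarrow> complex"
  assumes q: "norm q < 1" and r: "0 < r"
    and sum: "summable (\<lambda>n. norm (T n) * r ^ n)"
    and hol: "\<And>n. g n holomorphic_on UNIV"
    and bound: "\<And>n c. norm c \<le> r \<Longrightarrow> norm (g n c) \<le> M"
  defines "F \<equiv> \<lambda>c. \<Sum>n. T n * qshift q c n * g n c"
  shows "F holomorphic_on ball 0 r" "continuous_on (cball 0 r) F"
proof -
  let ?E = "exp (norm q / r / (1 - norm q))"
  have lim: "uniform_limit (cball 0 r) (\<lambda>N c. \<Sum>n<N. T n * qshift q c n * g n c) F sequentially"
    unfolding F_def
  proof (rule Weierstrass_m_test[where M = "\<lambda>n. ?E * M * (norm (T n) * r ^ n)"])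
    fix n c assume "c \<in> cball (0::complex) r"
    hence c: "norm c \<le> r" by simp
    have "norm (T n * qshift q c n * g n c) \<le> norm (T n) * (?E * r ^ n) * M"
      unfolding norm_mult using norm_qshift_le[OF q c r, of n] bound[OF c, of n]
      by (intro mult_mono mult_left_mono) (use r in auto)
    thus "norm (T n * qshift q c n * g n c) \<le> ?E * M * (norm (T n) * r ^ n)"
      by (simp add: mult_ac)
  qed (intro summable_mult sum)
  have "(\<lambda>c. \<Sum>n<N. T n * qshift q c n * g n c) holomorphic_on UNIV" for N
    unfolding qshift_def by (intro holomorphic_intros hol)
  hence "(\<lambda>c. \<Sum>n<N. T n * qshift q c n * g n c) holomorphic_on S" for N S
    by (rule holomorphic_on_subset) simp
  hence ev: "\<forall>\<^sub>F N in sequentially. continuous_on (cball 0 r) (\<lambda>c. \<Sum>n<N. T n * qshift q c n * g n c)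
      \<and> (\<lambda>c. \<Sum>n<N. T n * qshift q c n * g n c) holomorphic_on ball 0 r"
    by (intro always_eventually allI conjI holomorphic_on_imp_continuous_on)
  show "F holomorphic_on ball 0 r" "continuous_on (cball 0 r) F"
    by (rule holomorphic_uniform_limit[OF ev lim trivial_limit_sequentially], assumption)+
qed

text \<open>Converse to the bound above: if c is no q^(k+1), then (q/c; q)_n has a nonzero limit, so
  its reciprocal is bounded, and absolute convergence at c controls |T n| |c|^n. The denominator (y;
  q)_n is bounded above.\<close>

lemma summable_qshift_coeff:
  fixes T :: "nat \<Rightarrow> complex"
  assumes q: "norm q < 1" and c: "c \<noteq> 0" "\<And>k. c \<noteq> q ^ Suc k"
    and sum: "summable (\<lambda>n. norm (T n * qshift q c n / qpoch y q n))"
    and y: "\<And>n. qpoch y q n \<noteq> 0"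
  shows "summable (\<lambda>n. norm (T n) * norm c ^ n)"
proof -
  have "q / c * q ^ k \<noteq> 1" for k
    using c(2)[of k] c(1) by (auto simp: field_simps)
  hence nz: "qpoch_inf (q / c) q \<noteq> 0" by (intro qpoch_inf_nonzero[OF q])
  have "convergent (\<lambda>n. inverse (qpoch (q / c) q n))"
    using tendsto_inverse[OF qpoch_LIMSEQ[OF q] nz] by (auto simp: convergent_def)
  then obtain K where K: "K > 0" "\<And>n. norm (inverse (qpoch (q / c) q n)) \<le> K"
    using BseqE[OF convergent_imp_Bseq] by blast
  let ?E = "exp (norm y / (1 - norm q))"
  show ?thesis
  proof (rule summable_comparison_test'[where N=0])
    show "summable (\<lambda>n. K * ?E * norm (T n * qshift q c n / qpoch y q n))"
      by (intro summable_mult sum)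
  next
    fix n
    have "T n * c ^ n = inverse (qpoch (q / c) q n) * qpoch y q n * (T n * qshift q c n / qpoch y q n)"
      using qpoch_nonzero[OF q nz, of n] y[of n] c(1) by (simp add: qshift_eq field_simps)
    hence "norm (T n) * norm c ^ n
        = norm (inverse (qpoch (q / c) q n)) * norm (qpoch y q n) * norm (T n * qshift q c n / qpoch y q n)"
      by (metis norm_mult norm_power)
    also have "\<dots> \<le> K * ?E * norm (T n * qshift q c n / qpoch y q n)"
      using K norm_qpoch_le[OF q, of y n] by (intro mult_right_mono mult_mono) auto
    finally show "norm (norm (T n) * norm c ^ n) \<le> K * ?E * norm (T n * qshift q c n / qpoch y q n)"
      by simp
  qed
qed

subsection \<open>The transformation formula\<close>

text \<open>Both series terminate here and reduce to the same \<open>tphi\<close>. Denominators are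
  multiplied out because that is the form continued analytically in c.\<close>

lemma transformation_at_q_power:
  fixes q \<alpha> a b c \<beta> \<gamma> u v :: complex
  assumes q: "q \<noteq> 0" "norm q < 1" and nz: "a \<noteq> 0" "b \<noteq> 0" "u \<noteq> 0" "v \<noteq> 0" "\<alpha> \<noteq> 1"
    and den: "qpoch_inf (\<alpha> * a) q \<noteq> 0" "qpoch_inf (\<alpha> * b) q \<noteq> 0" "qpoch_inf (\<alpha> * c) q \<noteq> 0"
      "qpoch_inf (q / a) q \<noteq> 0" "qpoch_inf (q / b) q \<noteq> 0" "qpoch_inf \<beta> q \<noteq> 0" "qpoch_inf \<gamma> q \<noteq> 0"
      "qpoch_inf (\<beta> * \<gamma> * u * v) q \<noteq> 0"
      "qpoch_inf (\<alpha> * \<beta> * a * b / q) q \<noteq> 0" "qpoch_inf (\<alpha> * \<gamma> * a * b / q) q \<noteq> 0"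
    and c: "c = q ^ Suc N"
  shows "(\<Sum>n. lhs_term q \<alpha> a b c \<beta> \<gamma> u v n)
      * qpochs_inf [\<alpha> * a, \<alpha> * b, \<alpha> * c, \<alpha> * \<beta> * a * b * c / q ^ 2, \<alpha> * \<gamma> * a * b * c / q ^ 2,
                  \<beta> * \<gamma> * u * v] q
    = qpochs_inf [q * \<alpha>, \<alpha> * a * c / q, \<alpha> * b * c / q, \<alpha> * \<beta> * a * b / q, \<alpha> * \<gamma> * a * b / q,
                \<beta> * \<gamma> * c * u * v / q] q
      * qphi [q / c, \<alpha> * a * b / (q * u), \<alpha> * a * b / (q * v)]
           [\<alpha> * \<beta> * a * b / q, \<alpha> * \<gamma> * a * b / q] q (\<beta> * \<gamma> * c * u * v / q)"
proof -
  define x w where "x = \<alpha> * a * b / q" and "w = \<beta> * \<gamma> * u * v"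
  define R where "R = tphi q w (x / u) (x / v) (x * \<beta>) (x * \<gamma>) N"
  define \<Phi> where "\<Phi> = qphi [1 / q ^ N, x / u, x / v] [x * \<beta>, x * \<gamma>] q (w * q ^ N)"
  note nonzero = qpoch_nonzero[OF q(2)]
  have args: "q / c = 1 / q ^ N" "\<alpha> * a * b / (q * u) = x / u" "\<alpha> * a * b / (q * v) = x / v"
    "\<alpha> * \<beta> * a * b / q = x * \<beta>" "\<alpha> * \<gamma> * a * b / q = x * \<gamma>" "\<beta> * \<gamma> * c * u * v / q = w * q ^ N"
    "\<alpha> * a * c / q = \<alpha> * a * q ^ N" "\<alpha> * b * c / q = \<alpha> * b * q ^ N"
    "\<alpha> * \<beta> * a * b * c / q ^ 2 = x * \<beta> * q ^ N" "\<alpha> * \<gamma> * a * b * c / q ^ 2 = x * \<gamma> * q ^ N"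
    "\<alpha> * c = q * \<alpha> * q ^ N"
    using q by (simp_all add: c x_def w_def power2_eq_square field_simps)
  have 1: "qpoch (x * \<beta>) q N * qpoch (x * \<gamma>) q N * \<Phi> = qpoch q q N * R"
    unfolding \<Phi>_def R_def by (rule qphi_terminating[OF q]) (use den(9,10) nonzero in \<open>simp_all add: args\<close>)
  have "(\<Sum>n. lhs_term q \<alpha> a b c \<beta> \<gamma> u v n)
      = qpoch q q N * qpoch (q * \<alpha>) q N / (qpoch (\<alpha> * a) q N * qpoch (\<alpha> * b) q N * qpoch w q N) * R"
    unfolding R_def c x_def w_def
    by (rule lhs_terminating[OF q nz]) (use den c nonzero in auto)
  moreover have "qpoch (\<alpha> * a) q N \<noteq> 0" "qpoch (\<alpha> * b) q N \<noteq> 0" "qpoch w q N \<noteq> 0"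
    using den nonzero by (auto simp: w_def)
  ultimately have 2: "(\<Sum>n. lhs_term q \<alpha> a b c \<beta> \<gamma> u v n) * (qpoch (\<alpha> * a) q N * qpoch (\<alpha> * b) q N * qpoch w q N)
      = qpoch (q * \<alpha>) q N * (qpoch (x * \<beta>) q N * qpoch (x * \<gamma>) q N * \<Phi>)"
    unfolding 1 by simp
  have split: "qpoch_inf y q = qpoch y q N * qpoch_inf (y * q ^ N) q" for y
    by (rule qpoch_inf_split[OF q(2)])
  \<comment> \<open>After every product without a factor q^N in its argument is cut at N, the two
    sides share these six tails; only the finite parts in 2 differ.\<close>
  define Z where "Z = qpoch_inf (\<alpha> * a * q ^ N) q * qpoch_inf (\<alpha> * b * q ^ N) q * qpoch_inf (q * \<alpha> * q ^ N) q
      * qpoch_inf (x * \<beta> * q ^ N) q * qpoch_inf (x * \<gamma> * q ^ N) q * qpoch_inf (w * q ^ N) q"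
  have "(\<Sum>n. lhs_term q \<alpha> a b c \<beta> \<gamma> u v n)
      * qpochs_inf [\<alpha> * a, \<alpha> * b, q * \<alpha> * q ^ N, x * \<beta> * q ^ N, x * \<gamma> * q ^ N, w] q
    = (\<Sum>n. lhs_term q \<alpha> a b c \<beta> \<gamma> u v n) * (qpoch (\<alpha> * a) q N * qpoch (\<alpha> * b) q N * qpoch w q N) * Z"
    unfolding qpochs_inf_def list.map prod_list.Cons prod_list.Nil
      split[of "\<alpha> * a"] split[of "\<alpha> * b"] split[of w] Z_def by (simp only: mult_ac mult_1_left mult_1_right)
  also have "\<dots> = qpochs_inf [q * \<alpha>, \<alpha> * a * q ^ N, \<alpha> * b * q ^ N, x * \<beta>, x * \<gamma>, w * q ^ N] q * \<Phi>"
    unfolding 2 qpochs_inf_def list.map prod_list.Cons prod_list.Nil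
      split[of "q * \<alpha>"] split[of "x * \<beta>"] split[of "x * \<gamma>"] Z_def by (simp only: mult_ac mult_1_left mult_1_right)
  finally show ?thesis
    unfolding args w_def[symmetric] \<Phi>_def .
qed

theorem theorem1p4:
  fixes q \<alpha> a b c \<beta> \<gamma> u v :: complex
  assumes q: "0 < norm q" "norm q < 1"
    and nz: "a \<noteq> 0" "b \<noteq> 0" "c \<noteq> 0" "u \<noteq> 0" "v \<noteq> 0" "\<alpha> \<noteq> 1"
    and den: "qpochs_inf [\<alpha> * a, \<alpha> * b, \<alpha> * c, q / a, q / b, \<beta> * \<gamma> * u * v, \<beta>, \<gamma>,
                 \<alpha> * \<beta> * a * b / q, \<alpha> * \<gamma> * a * b / q,
                 \<alpha> * \<beta> * a * b * c / q ^ 2, \<alpha> * \<gamma> * a * b * c / q ^ 2] q \<noteq> 0"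
    and conv_lhs: "summable (\<lambda>n. norm (lhs_term q \<alpha> a b c \<beta> \<gamma> u v n))"
    and conv_rhs: "summable (\<lambda>n. norm (qphi_term [q / c, \<alpha> * a * b / (q * u), \<alpha> * a * b / (q * v)]
                    [\<alpha> * \<beta> * a * b / q, \<alpha> * \<gamma> * a * b / q] q (\<beta> * \<gamma> * c * u * v / q) n))"
  shows "(\<Sum>n. lhs_term q \<alpha> a b c \<beta> \<gamma> u v n) =
    qpochs_inf [q * \<alpha>, \<alpha> * a * c / q, \<alpha> * b * c / q, \<alpha> * \<beta> * a * b / q, \<alpha> * \<gamma> * a * b / q,
                \<beta> * \<gamma> * c * u * v / q] q
    / qpochs_inf [\<alpha> * a, \<alpha> * b, \<alpha> * c, \<alpha> * \<beta> * a * b * c / q ^ 2, \<alpha> * \<gamma> * a * b * c / q ^ 2,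
                  \<beta> * \<gamma> * u * v] q
    * qphi [q / c, \<alpha> * a * b / (q * u), \<alpha> * a * b / (q * v)]
           [\<alpha> * \<beta> * a * b / q, \<alpha> * \<gamma> * a * b / q] q (\<beta> * \<gamma> * c * u * v / q)"
proof -
  have q0: "q \<noteq> 0" using q by auto
  define S where "S = (\<lambda>c. \<Sum>n. lhs_term q \<alpha> a b c \<beta> \<gamma> u v n)"
  define \<Phi> where "\<Phi> = (\<lambda>c. qphi [q / c, \<alpha> * a * b / (q * u), \<alpha> * a * b / (q * v)]
           [\<alpha> * \<beta> * a * b / q, \<alpha> * \<gamma> * a * b / q] q (\<beta> * \<gamma> * c * u * v / q))"
  \<comment> \<open>The product (\<alpha> c; q)_\<infinity> is left out: it is absorbed term by term
    into the series \<open>F\<close> below.\<close>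
  define D where "D = (\<lambda>c. qpochs_inf [\<alpha> * a, \<alpha> * b, \<alpha> * \<beta> * a * b * c / q ^ 2, \<alpha> * \<gamma> * a * b * c / q ^ 2,
                  \<beta> * \<gamma> * u * v] q)"
  define E where "E = (\<lambda>c. qpochs_inf [q * \<alpha>, \<alpha> * a * c / q, \<alpha> * b * c / q, \<alpha> * \<beta> * a * b / q, \<alpha> * \<gamma> * a * b / q,
                \<beta> * \<gamma> * c * u * v / q] q)"
  have den': "qpoch_inf (\<alpha> * a) q \<noteq> 0" "qpoch_inf (\<alpha> * b) q \<noteq> 0" "qpoch_inf (\<alpha> * c) q \<noteq> 0"
      "qpoch_inf (q / a) q \<noteq> 0" "qpoch_inf (q / b) q \<noteq> 0" "qpoch_inf \<beta> q \<noteq> 0" "qpoch_inf \<gamma> q \<noteq> 0"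
      "qpoch_inf (\<beta> * \<gamma> * u * v) q \<noteq> 0"
      "qpoch_inf (\<alpha> * \<beta> * a * b / q) q \<noteq> 0" "qpoch_inf (\<alpha> * \<gamma> * a * b / q) q \<noteq> 0"
      "qpoch_inf (\<alpha> * \<beta> * a * b * c / q ^ 2) q \<noteq> 0" "qpoch_inf (\<alpha> * \<gamma> * a * b * c / q ^ 2) q \<noteq> 0"
    using den by (auto simp: qpochs_inf_def)
  have at_q_power: "S d * qpoch_inf (\<alpha> * d) q * D d = E d * \<Phi> d"
    if "d = q ^ Suc N" "qpoch_inf (\<alpha> * d) q \<noteq> 0" for d N
    using transformation_at_q_power[OF q0 q(2) nz(1,2,4-6) den'(1,2) that(2) den'(4-10) that(1)]
    by (simp add: S_def \<Phi>_def D_def E_def qpochs_inf_def mult_ac)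
  have main: "S c * qpoch_inf (\<alpha> * c) q * D c = E c * \<Phi> c"
  proof (cases "\<exists>N. c = q ^ Suc N")
    case True
    thus ?thesis using at_q_power den'(3) by blast
  next
    \<comment> \<open>Excluding the points q^(N+1) is essential for
      \<open>summable_qshift_coeff\<close>, since (q/c; q)_n eventually vanishes there and
      convergence says nothing about the coefficients.\<close>
    case False
    \<comment> \<open>\<open>T\<close> and \<open>T'\<close> collect everything independent of c;
      the remaining dependence is \<open>qshift\<close> and, on the left only, 1/(\<alpha> c;
      q)_n.\<close>
    define T where "T = (\<lambda>n. (1 - \<alpha> * q ^ (2 * n)) * qpochs [\<alpha>, q / a, q / b] q n
       / ((1 - \<alpha>) * qpochs [q, \<alpha> * a, \<alpha> * b] q n) * (\<alpha> * a * b / q ^ 2) ^ n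
       * (\<Sum>k\<le>n. qpochs [1 / q ^ n, \<alpha> * q ^ n, \<beta>, \<gamma>] q k * q ^ k
                  / qpochs [q, q / a, q / b, \<beta> * \<gamma> * u * v] q k
                  * qphi [1 / q ^ k, 1 / u, 1 / v] [\<beta>, \<gamma>] q (\<beta> * \<gamma> * u * v * q ^ k)))"
    define T' where "T' = (\<lambda>n. qpochs [\<alpha> * a * b / (q * u), \<alpha> * a * b / (q * v)] q n
       / qpochs [q, \<alpha> * \<beta> * a * b / q, \<alpha> * \<gamma> * a * b / q] q n * (\<beta> * \<gamma> * u * v / q) ^ n)"
    have lhs: "lhs_term q \<alpha> a b d \<beta> \<gamma> u v n = T n * qshift q d n / qpoch (\<alpha> * d) q n" if "d \<noteq> 0" for d n
      using that unfolding lhs_term_def T_def qpochs_def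
      by (simp add: qshift_eq power_divide power_mult_distrib divide_inverse mult_ac)
    have rhs: "qphi_term [q / d, \<alpha> * a * b / (q * u), \<alpha> * a * b / (q * v)]
        [\<alpha> * \<beta> * a * b / q, \<alpha> * \<gamma> * a * b / q] q (\<beta> * \<gamma> * d * u * v / q) n = T' n * qshift q d n"
      if "d \<noteq> 0" for d n
      using that unfolding qphi_term_def T'_def qpochs_def
      by (simp add: qshift_eq power_divide power_mult_distrib divide_inverse mult_ac)
    define r where "r = norm c"
    have r: "0 < r" using nz by (simp add: r_def)
    have sum_T: "summable (\<lambda>n. norm (T n) * r ^ n)"
      unfolding r_def
      by (rule summable_qshift_coeff[OF q(2) nz(3), where y="\<alpha> * c"])
         (use False conv_lhs lhs[OF nz(3)] qpoch_nonzero[OF q(2) den'(3)] in auto)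
    have sum_T': "summable (\<lambda>n. norm (T' n) * r ^ n)"
      unfolding r_def
      by (rule summable_qshift_coeff[OF q(2) nz(3), where y=0])
         (use False conv_rhs rhs[OF nz(3)] in auto)
    \<comment> \<open>By (\<alpha> d; q)_\<infinity> / (\<alpha> d; q)_n = (\<alpha> q^n d;
      q)_\<infinity>, multiplying the left series by (\<alpha> d; q)_\<infinity> removes all poles
      in d.\<close>
    define F where "F = (\<lambda>d. \<Sum>n. T n * qshift q d n * qpoch_inf (\<alpha> * q ^ n * d) q)"
    define G where "G = (\<lambda>d. \<Sum>n. T' n * qshift q d n * 1)"
    have F: "F holomorphic_on ball 0 r" "continuous_on (cball 0 r) F"
    proof -
      have hol: "(\<lambda>d. qpoch_inf (\<alpha> * q ^ n * d) q) holomorphic_on UNIV" for n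
        by (intro holomorphic_intros q)
      have bound: "norm (qpoch_inf (\<alpha> * q ^ n * d) q) \<le> exp (norm \<alpha> * r / (1 - norm q))"
        if "norm d \<le> r" for n d
      proof -
        have "norm (\<alpha> * q ^ n * d) \<le> norm \<alpha> * 1 * r"
          unfolding norm_mult norm_power using q that
          by (intro mult_mono mult_left_mono power_le_one) auto
        hence "exp (norm (\<alpha> * q ^ n * d) / (1 - norm q)) \<le> exp (norm \<alpha> * r / (1 - norm q))"
          using q by (simp add: divide_right_mono)
        thus ?thesis using norm_qpoch_inf_le[OF q(2)] order_trans by blast
      qed
      show "F holomorphic_on ball 0 r" "continuous_on (cball 0 r) F"
        unfolding F_def by (rule qshift_series[OF q(2) r sum_T hol bound], assumption)+
    qed
    have G: "G holomorphic_on ball 0 r" "continuous_on (cball 0 r) G"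
      unfolding G_def by (rule qshift_series[OF q(2) r sum_T', where M=1]; simp)+
    have F_eq: "F d = S d * qpoch_inf (\<alpha> * d) q" if "d \<noteq> 0" "qpoch_inf (\<alpha> * d) q \<noteq> 0"
      "summable (\<lambda>n. lhs_term q \<alpha> a b d \<beta> \<gamma> u v n)" for d
    proof -
      have "T n * qshift q d n * qpoch_inf (\<alpha> * q ^ n * d) q = lhs_term q \<alpha> a b d \<beta> \<gamma> u v n * qpoch_inf (\<alpha> * d) q" for n
        using lhs[OF that(1)] qpoch_nonzero[OF q(2) that(2), of n] qpoch_inf_split[OF q(2), of "\<alpha> * d" n]
        by (simp add: mult_ac)
      thus ?thesis unfolding F_def S_def using suminf_mult2[OF that(3)] by simp
    qed
    have G_eq: "G d = \<Phi> d" if "d \<noteq> 0" for d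
      unfolding G_def \<Phi>_def qphi_def rhs[OF that] by simp
    define h where "h = (\<lambda>d. F d * D d - E d * G d)"
    have DE: "D holomorphic_on A" "E holomorphic_on A" for A
      unfolding D_def E_def qpochs_inf_def list.map prod_list.Cons prod_list.Nil
      using q0 by (intro holomorphic_intros q; simp)+
    have h_hol: "h holomorphic_on ball 0 r"
      unfolding h_def by (intro holomorphic_intros F G DE)
    have h_cont: "continuous_on (cball 0 r) h"
      unfolding h_def by (intro continuous_intros F G holomorphic_on_imp_continuous_on[OF DE(1)]
          holomorphic_on_imp_continuous_on[OF DE(2)])
    have lim: "(\<lambda>N. q ^ Suc N) \<longlonglongrightarrow> 0"
      using LIMSEQ_power_zero[OF q(2)] by (rule LIMSEQ_Suc)
    have "\<forall>\<^sub>F N in sequentially. norm (q ^ Suc N) < r"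
      using tendsto_norm_zero[OF lim] r by (rule order_tendstoD)
    moreover have "(\<lambda>N. norm (\<alpha> * q ^ Suc N)) \<longlonglongrightarrow> 0"
      using tendsto_norm_zero[OF tendsto_mult_right_zero[OF lim]] by simp
    hence "\<forall>\<^sub>F N in sequentially. norm (\<alpha> * q ^ Suc N) < 1"
      by (rule order_tendstoD) simp
    ultimately have ev: "\<forall>\<^sub>F N in sequentially. norm (q ^ Suc N) < r \<and> norm (\<alpha> * q ^ Suc N) < 1"
      by (rule eventually_conj)
    \<comment> \<open>The condition |\<alpha> d| < 1 ensures that (\<alpha> d; q)_\<infinity> is
      nonzero, as \<open>at_q_power\<close> demands; it holds for all large N.\<close>
    define U where "U = {d. \<exists>N. d = q ^ Suc N \<and> norm d < r \<and> norm (\<alpha> * d) < 1}"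
    have h_U: "h d = 0" if "d \<in> U" for d
    proof -
      obtain N where N: "d = q ^ Suc N" and d: "norm (\<alpha> * d) < 1" using \<open>d \<in> U\<close> by (auto simp: U_def)
      have d0: "d \<noteq> 0" using q0 N by simp
      have nz: "qpoch_inf (\<alpha> * d) q \<noteq> 0" by (rule qpoch_inf_nonzero_of_norm_less[OF q(2) d])
      have "summable (\<lambda>n. lhs_term q \<alpha> a b d \<beta> \<gamma> u v n)"
      proof (rule summable_finite[of "{..N}"])
        fix n assume "n \<notin> {..N}"
        hence "qshift q d n = 0" by (auto simp: qshift_def N intro!: bexI[of _ N])
        thus "lhs_term q \<alpha> a b d \<beta> \<gamma> u v n = 0" by (simp add: lhs[OF d0])
      qed simp
      thus ?thesis
        using at_q_power[OF N nz] F_eq[OF d0 nz] G_eq[OF d0] by (simp add: h_def)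
    qed
    have "(0::complex) islimpt U"
      unfolding islimpt_sequential
    proof -
      obtain N0 where N0: "\<And>N. N \<ge> N0 \<Longrightarrow> norm (q ^ Suc N) < r \<and> norm (\<alpha> * q ^ Suc N) < 1"
        using ev by (auto simp: eventually_sequentially)
      show "\<exists>f. (\<forall>n. f n \<in> U - {0}) \<and> f \<longlonglongrightarrow> 0"
      proof (intro exI[of _ "\<lambda>n. q ^ Suc (n + N0)"] conjI allI)
        show "q ^ Suc (n + N0) \<in> U - {0}" for n
        proof
          show "q ^ Suc (n + N0) \<in> U"
            unfolding U_def using N0[of "n + N0"] by (intro CollectI exI[of _ "n + N0"] conjI refl) auto
        qed (use q0 in simp)
        show "(\<lambda>n. q ^ Suc (n + N0)) \<longlonglongrightarrow> 0"
          using LIMSEQ_ignore_initial_segment[OF lim, of N0] .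
      qed
    qed
    hence "h d = 0" if "d \<in> ball 0 r" for d
      by (rule analytic_continuation[OF h_hol open_ball connected_ball, of U 0, rotated 2])
         (use that r h_U in \<open>auto simp: U_def\<close>)
    \<comment> \<open>Since r = |c|, the point c lies on the boundary circle and is reached by
      continuity from inside.\<close>
    hence "h c = 0"
      using continuous_constant_on_closure[of "ball 0 r" h 0 c] h_cont r by (simp add: r_def)
    thus ?thesis
      using F_eq[OF nz(3) den'(3) summable_norm_cancel[OF conv_lhs]] G_eq[OF nz(3)] by (simp add: h_def)
  qed
  have "D c \<noteq> 0" using den' by (simp add: D_def qpochs_inf_def)
  hence "S c = E c / (qpoch_inf (\<alpha> * c) q * D c) * \<Phi> c"
    using main den'(3) by (simp add: field_simps)
  moreover have "qpoch_inf (\<alpha> * c) q * D c = qpochs_inf [\<alpha> * a, \<alpha> * b, \<alpha> * c, \<alpha> * \<beta> * a * b * c / q ^ 2, \<alpha> * \<gamma> * a * b * c / q ^ 2,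
                  \<beta> * \<gamma> * u * v] q"
    by (simp add: D_def qpochs_inf_def mult_ac)
  ultimately show ?thesis by (simp add: S_def E_def \<Phi>_def)
qed

end
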